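(* $\widehat\sigma_d<\sigma_d$ for all $d\ge 8$.
   Context: Definition of $\sigma_d$. Take a regular $d$-dimensional simplex of edge length $2$ in $\mathbf{E}^d$ and draw a $d$-dimensional unit ball around each vertex; $\sigma_d$ is the ratio of the volume of the portion of the simplex covered by the balls to the volume of the simplex. Definition of $\widehat\sigma_d$. Let $\mathbf{o}$ be the origin, $B=\{\mathbf{x}\in\mathbf{E}^d:\|\mathbf{x}\|\le 1\}$ and $S=\{\mathbf{x}\in\mathbf{E}^d:\|\mathbf{x}\|=1\}$. Let $\mathrm{conv}\{\mathbf{o},\mathbf{w}_1,\dots,\mathbf{w}_d\}$ be a $d$-dimensional simplex in $\mathbf{E}^d$ such that for all $1\le i\le d-1$ the linear hull $\mathrm{lin}\{\mathbf{w}_j-\mathbf{w}_i : i<j\le d\}$ is orthogonal to the vector $\mathbf{w}_i$, and $\|\mathbf{w}_i\|=\sqrt{\frac{2i}{i+1}}$ for all $1\le i\le d$. The triangle $\triangle\mathbf{w}_{d-2}\mathbf{w}_{d-1}\mathbf{w}_d$ has a right angle at $\mathbf{w}_{d-1}$, and $\angle\mathbf{w}_{d-1}\mathbf{w}_{d-2}\mathbf{w}_d<\frac{\pi}{4}$. In the plane $\mathrm{aff}\{\mathbf{w}_{d-2},\mathbf{w}_{d-1},\mathbf{w}_d\}$ let $\mathcal{C}$ be the circular sector with center $\mathbf{w}_{d-2}$, radius $\|\mathbf{w}_d-\mathbf{w}_{d-2}\|=\|\mathbf{w}_{d+1}-\mathbf{w}_{d-2}\|$ and central angle $\angle\mathbf{w}_d\mathbf{w}_{d-2}\mathbf{w}_{d+1}=\frac{\pi}{4}-\angle\mathbf{w}_{d-1}\mathbf{w}_{d-2}\mathbf{w}_d$,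 over the circular arc with endpoints $\mathbf{w}_d,\mathbf{w}_{d+1}$, such that $\mathcal{C}$ and the triangle are adjacent along the segment $\mathbf{w}_{d-2}\mathbf{w}_d$ and are separated by the line of $\mathbf{w}_{d-2}\mathbf{w}_d$. Let $D=\triangle\mathbf{w}_{d-2}\mathbf{w}_{d-1}\mathbf{w}_d\cup\mathcal{C}$ (a convex domain), $W=\mathrm{conv}(\{\mathbf{o},\mathbf{w}_1,\dots,\mathbf{w}_{d-3}\}\cup D)$ and $Q_W=\mathrm{conv}(\{\mathbf{w}_1,\dots,\mathbf{w}_{d-3}\}\cup D)$. Then $$\widehat\sigma_d=\frac{\mathrm{SVol}_{d-1}(W\cap S)}{\mathrm{Vol}_{d-1}(Q_W)}=\frac{\mathrm{Vol}_d(W\cap B)}{\mathrm{Vol}_d(W)},$$ where $\mathrm{Vol}_k$ is $k$-dimensional Euclidean volume and $\mathrm{SVol}_{d-1}$ is $(d-1)$-dimensional spherical volume. *)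

theory Defs
  imports "HOL-Analysis.Analysis"
begin

text \<open>
  The space \<open>E\<^sup>d\<close> is \<^typ>\<open>real^'n\<close>, so that \<open>d\<close> is \<open>CARD('n)\<close>. Both densities are defined on a
  configuration (the vertices of the regular simplex, respectively the points
  \<open>w 1, \<dots>, w (d + 1)\<close>). The configurations are determined by their defining conditions up to
  isometry, and they exist (\<open>ex_regular_simplex\<close> and \<open>ex_arc_endpoint\<close> below).
\<close>

definition regular_simplex_vertices :: "real \<Rightarrow> (real^'n) set \<Rightarrow> bool" where
  "regular_simplex_vertices l V \<longleftrightarrow>
     \<not> affine_dependent V \<and> card V = CARD('n) + 1 \<and> pairwise (\<lambda>x y. dist x y = l) V"

definition rogers_sigma :: "(real^'n) set \<Rightarrow> real" where
  "rogers_sigma V = measure lebesgue (convex hull V \<inter> (\<Union>v\<in>V. cball v 1))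
           / measure lebesgue (convex hull V)"

definition angle_at :: "real^'n \<Rightarrow> real^'n \<Rightarrow> real^'n \<Rightarrow> real" where
  "angle_at c a b = arccos (((a - c) \<bullet> (b - c)) / (norm (a - c) * norm (b - c)))"

text \<open>The sector with centre \<open>c\<close> over the shorter circular arc from \<open>a\<close> to \<open>b\<close>; it is meant for
  \<open>dist c a = dist c b\<close> and an angle less than \<open>\<pi>\<close>.\<close>

definition circular_sector :: "real^'n \<Rightarrow> real^'n \<Rightarrow> real^'n \<Rightarrow> (real^'n) set" where
  "circular_sector c a b =
     cball c (dist c a) \<inter> {c + s *\<^sub>R (a - c) + t *\<^sub>R (b - c) | s t. 0 \<le> s \<and> 0 \<le> t}"

definition orthoscheme_vertices :: "(nat \<Rightarrow> real^'n) \<Rightarrow> bool" where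
  "orthoscheme_vertices w \<longleftrightarrow> (let d = CARD('n) in
     int d simplex (convex hull (insert 0 (w ` {1..d}))) \<and>
     (\<forall>i\<in>{1..d-1}. \<forall>x\<in>span {w j - w i | j. i < j \<and> j \<le> d}. orthogonal x (w i)) \<and>
     (\<forall>i\<in>{1..d}. norm (w i) = sqrt (2 * real i / (real i + 1))))"

definition corner_triangle :: "(nat \<Rightarrow> real^'n) \<Rightarrow> (real^'n) set" where
  "corner_triangle w = (let d = CARD('n) in convex hull {w (d-2), w (d-1), w d})"

definition corner_sector :: "(nat \<Rightarrow> real^'n) \<Rightarrow> (real^'n) set" where
  "corner_sector w = (let d = CARD('n) in circular_sector (w (d-2)) (w d) (w (d+1)))"

text \<open>The conditions on \<open>w (d + 1)\<close>. A line of the plane \<open>P\<close> is cut out by a hyperplane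
  \<open>{x. n \<bullet> x = b}\<close> of the space, whose two sides induce the two sides of the line in \<open>P\<close>.\<close>

definition arc_endpoint :: "(nat \<Rightarrow> real^'n) \<Rightarrow> bool" where
  "arc_endpoint w \<longleftrightarrow> (let d = CARD('n); P = affine hull {w (d-2), w (d-1), w d} in
     w (d+1) \<in> P \<and>
     norm (w (d+1) - w (d-2)) = norm (w d - w (d-2)) \<and>
     angle_at (w (d-2)) (w d) (w (d+1)) = pi / 4 - angle_at (w (d-2)) (w (d-1)) (w d) \<and>
     corner_triangle w \<inter> corner_sector w = closed_segment (w (d-2)) (w d) \<and>
     (\<exists>n b. P \<inter> {x. n \<bullet> x = b} = affine hull {w (d-2), w d} \<and>
        (\<forall>x\<in>corner_triangle w. n \<bullet> x \<le> b) \<and> (\<forall>x\<in>corner_sector w. b \<le> n \<bullet> x)))"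

definition convex_body_W :: "(nat \<Rightarrow> real^'n) \<Rightarrow> (real^'n) set" where
  "convex_body_W w = convex hull (insert 0 (w ` {1..CARD('n)-3}) \<union> (corner_triangle w \<union> corner_sector w))"

text \<open>This is the volume form of the density. It agrees with the quotient of the spherical volume
  of \<open>W \<inter> S\<close> by the volume of \<open>Q\<^sub>W\<close>: the set \<open>Q\<^sub>W\<close> lies in the tangent hyperplane
  of the unit sphere at \<open>w 1\<close>, so that \<open>W\<close> and \<open>W \<inter> B\<close> are the cones with apex \<open>0\<close>
  over \<open>Q\<^sub>W\<close> and \<open>W \<inter> S\<close>, and both of their volumes carry the factor \<open>1 / d\<close>.\<close>

definition rogers_sigma_hat :: "(nat \<Rightarrow> real^'n) \<Rightarrow> real" where
  "rogers_sigma_hat w = measure lebesgue (convex_body_W w \<inter> cball 0 1) / measure lebesgue (convex_body_W w)"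

lemma equidistant_affine_independent:
  fixes V :: "('a::real_inner) set"
  assumes "finite V" and "l \<noteq> 0" and d: "pairwise (\<lambda>x y. dist x y = l) V"
  shows "\<not> affine_dependent V"
proof
  assume "affine_dependent V"
  then obtain u z where u: "sum u V = 0" "(\<Sum>v\<in>V. u v *\<^sub>R v) = 0" and z: "z \<in> V" "u z \<noteq> 0"
    using affine_dependent_explicit_finite[OF \<open>finite V\<close>] by auto
  define K where "K = (\<Sum>y\<in>V. u y * (y \<bullet> y))"
  have "l\<^sup>2 * u x = - K" if x: "x \<in> V" for x
  proof -
    have *: "u y * (dist x y)\<^sup>2 = (x \<bullet> x) * u y + u y * (y \<bullet> y) - 2 * (x \<bullet> (u y *\<^sub>R y))" for y
      by (simp add: dist_norm power2_norm_eq_inner inner_diff_left inner_diff_right inner_commute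
          algebra_simps)
    have "(\<Sum>y\<in>V. u y * (dist x y)\<^sup>2)
        = (x \<bullet> x) * sum u V + K - 2 * (x \<bullet> (\<Sum>y\<in>V. u y *\<^sub>R y))"
      unfolding * K_def inner_sum_right by (simp add: sum.distrib sum_subtractf sum_distrib_left)
    then have 1: "(\<Sum>y\<in>V. u y * (dist x y)\<^sup>2) = K" by (simp add: u)
    have "(\<Sum>y\<in>V. u y * (dist x y)\<^sup>2) = (\<Sum>y\<in>V - {x}. u y * (dist x y)\<^sup>2)"
      using x \<open>finite V\<close> by (simp add: sum.remove)
    also have "\<dots> = (\<Sum>y\<in>V - {x}. u y * l\<^sup>2)"
      using d x by (intro sum.cong) (auto simp: pairwise_def)
    also have "\<dots> = (sum u V - u x) * l\<^sup>2"
      using x \<open>finite V\<close> by (simp add: sum_distrib_right[symmetric] sum.remove)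
    finally show ?thesis using 1 by (simp add: u)
  qed
  then have c: "u x = - K / l\<^sup>2" if "x \<in> V" for x
    using that \<open>l \<noteq> 0\<close> by (simp add: field_simps)
  then have "sum u V = real (card V) * (- K / l\<^sup>2)" by simp
  then have "- K / l\<^sup>2 = 0" using u(1) z(1) \<open>finite V\<close> by auto
  then show False using c z by simp
qed

lemma ex_regular_simplex: "\<exists>V :: (real^'n) set. regular_simplex_vertices 2 V"
proof -
  define N where "N = real CARD('n)"
  have N: "N > 0" by (simp add: N_def)
  define t where "t = (sqrt 2 + sqrt (2 + 2 * N)) / N"
  have t: "N * t\<^sup>2 - 2 * sqrt 2 * t = 2"
  proof -
    have "N * t = sqrt 2 + sqrt (2 + 2 * N)" using N by (simp add: t_def)
    then have "(N * t - sqrt 2)\<^sup>2 = 2 + 2 * N" using N by simp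
    then have "N * (N * t\<^sup>2 - 2 * sqrt 2 * t) = N * 2" by (simp add: power2_eq_square algebra_simps)
    then show ?thesis using N by simp
  qed
  define p :: "real^'n" where "p = (\<chi> i. t)"
  define f :: "'n \<Rightarrow> real^'n" where "f i = axis i (sqrt 2)" for i
  have ff: "f i \<bullet> f j = (if i = j then 2 else 0)" for i j
    by (simp add: f_def inner_axis_axis)
  have fp: "f i \<bullet> p = sqrt 2 * t" "p \<bullet> f i = sqrt 2 * t" for i
    by (simp_all add: f_def p_def inner_axis inner_axis' mult.commute)
  have pp: "p \<bullet> p = N * t\<^sup>2" by (simp add: p_def inner_vec_def N_def power2_eq_square)
  have df: "dist (f i) (f j) = 2" if "i \<noteq> j" for i j
    using that by (simp add: dist_norm norm_eq_sqrt_inner inner_diff ff)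
  have dp: "dist (f i) p = 2" for i
  proof -
    have "(f i - p) \<bullet> (f i - p) = 4"
      using t by (simp add: inner_diff_left inner_diff_right ff fp pp mult.commute mult.left_commute)
    then show ?thesis by (simp add: dist_norm norm_eq_sqrt_inner)
  qed
  have inj: "inj f" using df by (metis dist_self injI zero_neq_numeral)
  have notin: "p \<notin> range f" using dp by (metis dist_self imageE zero_neq_numeral)
  have pw: "pairwise (\<lambda>x y. dist x y = 2) (insert p (range f))"
  proof -
    have "dist (f i) (f j) = 2" if "f i \<noteq> f j" for i j
      using df that by metis
    then have "pairwise (\<lambda>x y. dist x y = 2) (range f)" by (simp add: pairwise_image pairwise_def)
    then show ?thesis using dp by (auto simp: pairwise_insert dist_commute[of p])
  qed
  have "card (insert p (range f)) = CARD('n) + 1"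
    using inj notin by (simp add: card_image)
  then show ?thesis
    unfolding regular_simplex_vertices_def
    using pw equidistant_affine_independent[OF _ _ pw] by (intro exI[of _ "insert p (range f)"]) auto
qed

lemma ex_orthonormal_sequence:
  "\<exists>e :: nat \<Rightarrow> real^'n. (\<forall>i\<in>{1..CARD('n)}. \<forall>j\<in>{1..CARD('n)}. e i \<bullet> e j = (if i = j then 1 else 0))
     \<and> span (e ` {1..CARD('n)}) = UNIV"
proof -
  obtain h where h: "bij_betw h {1..CARD('n)} (UNIV :: 'n set)"
    using ex_bij_betw_nat_finite_1[of "UNIV :: 'n set"] by auto
  have "(\<lambda>i. axis (h i) 1 :: real^'n) ` {1..CARD('n)} = (\<lambda>k. axis k 1) ` (h ` {1..CARD('n)})"
    by (simp add: image_image)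
  also have "\<dots> = Basis" using h by (auto simp: bij_betw_def Basis_vec_def)
  finally have "span ((\<lambda>i. axis (h i) 1 :: real^'n) ` {1..CARD('n)}) = UNIV" by simp
  moreover have "axis (h i) 1 \<bullet> (axis (h j) 1 :: real^'n) = (if i = j then 1 else 0)"
    if "i \<in> {1..CARD('n)}" "j \<in> {1..CARD('n)}" for i j
  proof -
    have "h i = h j \<longleftrightarrow> i = j" using that h by (meson bij_betw_imp_inj_on inj_on_eq_iff)
    then show ?thesis by (simp add: inner_axis_axis)
  qed
  ultimately show ?thesis by (intro exI[of _ "\<lambda>i. axis (h i) 1"]) auto
qed

lemma ex_arc_endpoint:
  assumes d3: "CARD('n) \<ge> 3"
  shows "\<exists>w :: nat \<Rightarrow> real^'n. orthoscheme_vertices w \<and> arc_endpoint w"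
proof -
  define d where "d = CARD('n)"
  have d: "d \<ge> 3" using d3 by (simp add: d_def)
  obtain e :: "nat \<Rightarrow> real^'n"
    where e: "\<And>i j. i \<in> {1..d} \<Longrightarrow> j \<in> {1..d} \<Longrightarrow> e i \<bullet> e j = (if i = j then 1 else 0)"
      and sp: "span (e ` {1..d}) = UNIV"
    using ex_orthonormal_sequence[where 'n = 'n] unfolding d_def by blast
  define a where "a k = sqrt (2 / (real k * (real k + 1)))" for k :: nat
  have a_pos: "a k > 0" if "k \<ge> 1" for k using that by (simp add: a_def)
  have a2: "(a k)\<^sup>2 = 2 / (real k * (real k + 1))" for k by (simp add: a_def)
  define p where "p i = (\<Sum>k=1..i. a k *\<^sub>R e k)" for i
  define A where "A = a (d-1)"
  define B where "B = a d"
  define r where "r = sqrt (A\<^sup>2 + B\<^sup>2)"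
  define u where "u = e (d-1)"
  define v where "v = e d"
  define c where "c = p (d-2)"
  define w where "w i = (if i \<le> d then p i else c + (r / sqrt 2) *\<^sub>R (u + v))" for i
  have uv: "u \<bullet> u = 1" "v \<bullet> v = 1" "u \<bullet> v = 0" "v \<bullet> u = 0"
    using d by (auto simp: u_def v_def e)
  have AB: "B > 0" "A > B"
  proof -
    show "B > 0" using a_pos d by (simp add: B_def)
    show "A > B" unfolding A_def B_def a_def using d
      by (intro real_sqrt_less_mono divide_strict_left_mono mult_strict_mono) auto
  qed
  have r: "r\<^sup>2 = A\<^sup>2 + B\<^sup>2" "r > 0"
    using AB by (auto simp: r_def intro!: add_pos_pos)
  have w2: "w (d-2) = c" using d by (simp add: w_def c_def)
  have w1: "w (d-1) = c + A *\<^sub>R u"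
  proof -
    have "d - 1 = Suc (d - 2)" using d by simp
    then have "p (d-1) = c + A *\<^sub>R u" by (simp add: p_def c_def A_def u_def)
    then show ?thesis by (simp add: w_def)
  qed
  have w0: "w d = c + A *\<^sub>R u + B *\<^sub>R v"
  proof -
    obtain m where "d = Suc m" using d by (cases d) auto
    then have "p d = p (d-1) + a d *\<^sub>R e d" by (simp add: p_def)
    moreover have "p (d-1) = c + A *\<^sub>R u" using w1 by (simp add: w_def)
    ultimately show ?thesis by (simp add: w_def B_def v_def)
  qed
  have ws: "w (d+1) = c + (r / sqrt 2) *\<^sub>R (u + v)" by (simp add: w_def)

  have pe: "p i \<bullet> p j = (\<Sum>k=1..i. (a k)\<^sup>2)" if "i \<le> j" "j \<le> d" for i j
  proof -
    have "(a k *\<^sub>R e k) \<bullet> p j = (a k)\<^sup>2" if "k \<in> {1..i}" for k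
    proof -
      have "(a k *\<^sub>R e k) \<bullet> p j = (\<Sum>m=1..j. if k = m then (a k)\<^sup>2 else 0)"
        unfolding p_def inner_sum_right using that \<open>i \<le> j\<close> \<open>j \<le> d\<close>
        by (intro sum.cong) (auto simp: e power2_eq_square)
      then show ?thesis using that \<open>i \<le> j\<close> by simp
    qed
    then show ?thesis by (simp add: p_def[of i] inner_sum_left)
  qed
  have sum_a: "(\<Sum>k=1..i. (a k)\<^sup>2) = 2 * real i / (real i + 1)" for i
  proof (induction i)
    case (Suc i)
    have "(\<Sum>k=1..Suc i. (a k)\<^sup>2) = 2 * real i / (real i + 1) + 2 / ((real i + 1) * (real i + 2))"
      using Suc by (simp add: a2 add.commute)
    also have "\<dots> = 2 * (real i + 1) / (real i + 2)"
      by (simp add: divide_simps) (simp add: algebra_simps)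
    finally show ?case by (simp add: add.commute)
  qed simp
  have indep: "independent (p ` {1..d}) \<and> card (p ` {1..d}) = d"
  proof -
    have "e i \<in> span (p ` {1..d})" if i: "i \<in> {1..d}" for i
    proof -
      obtain m where m: "i = Suc m" using i by (cases i) auto
      have "p m \<in> span (p ` {1..d})"
      proof (cases "m = 0")
        case True
        then show ?thesis by (simp add: p_def span_zero)
      next
        case False
        then show ?thesis using that m by (intro span_base imageI) auto
      qed
      moreover have "p i \<in> span (p ` {1..d})" using that by (intro span_base imageI)
      ultimately have "p i - p m \<in> span (p ` {1..d})" by (rule span_diff[rotated])
      then have "a i *\<^sub>R e i \<in> span (p ` {1..d})" by (simp add: p_def m)
      then have "(1 / a i) *\<^sub>R a i *\<^sub>R e i \<in> span (p ` {1..d})" by (rule span_scale)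
      then show ?thesis using a_pos[of i] m by simp
    qed
    then have "span (e ` {1..d}) \<subseteq> span (p ` {1..d})"
      by (intro span_minimal) auto
    then have S: "span (p ` {1..d}) = UNIV" using sp by auto
    have D: "dim (UNIV :: (real^'n) set) = d" by (simp add: d_def)
    have c: "card (p ` {1..d}) \<le> d" using card_image_le[of "{1..d}" p] by simp
    have "independent (p ` {1..d})"
      by (rule card_le_dim_spanning[of _ UNIV]) (use S D c in auto)
    moreover have "d \<le> card (p ` {1..d})"
      using span_card_ge_dim[of "p ` {1..d}" UNIV] S D by auto
    ultimately show ?thesis using c by auto
  qed
  have wp: "w ` {1..d} = p ` {1..d}" by (intro image_cong) (auto simp: w_def)
  have "0 \<notin> p ` {1..d}" using indep dependent_zero by blast
  then have simp: "int d simplex (convex hull (insert 0 (w ` {1..d})))"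
    unfolding simplex_def wp using indep affine_dependent_imp_dependent2[of "p ` {1..d}"]
    by (intro exI[of _ "insert 0 (p ` {1..d})"]) auto
  have orth: "orthogonal x (w i)"
    if "i \<in> {1..d-1}" "x \<in> span {w j - w i | j. i < j \<and> j \<le> d}" for x i
  proof -
    have "orthogonal (w i) y" if "y \<in> {w j - w i | j. i < j \<and> j \<le> d}" for y
      using that \<open>i \<in> {1..d-1}\<close> by (auto simp: orthogonal_def w_def inner_diff pe)
    then have "orthogonal (w i) x" by (rule orthogonal_to_span[OF that(2)])
    then show ?thesis by (simp only: orthogonal_commute)
  qed
  have nrm: "norm (w i) = sqrt (2 * real i / (real i + 1))" if "i \<in> {1..d}" for i
    using that by (simp add: w_def norm_eq_sqrt_inner pe sum_a[simplified])
  have "orthoscheme_vertices w"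
    unfolding orthoscheme_vertices_def Let_def d_def[symmetric] using simp orth nrm by blast

  moreover have "arc_endpoint w"
  proof -
    define q where "q = r / sqrt 2"
    have q: "q > 0" using r by (simp add: q_def)
    have wq: "w (d+1) = c + q *\<^sub>R (u + v)" unfolding ws q_def ..
    have nr: "norm (A *\<^sub>R u + B *\<^sub>R v) = r"
      by (simp add: norm_eq_sqrt_inner inner_add uv r_def power2_eq_square)
    have nq: "norm (q *\<^sub>R (u + v)) = r"
    proof -
      have "norm (u + v) = sqrt 2" by (simp add: norm_eq_sqrt_inner inner_add uv)
      then show ?thesis using r by (simp add: q_def)
    qed
    have nA: "norm (A *\<^sub>R u) = A" using AB by (simp add: norm_eq_sqrt_inner uv)
    define \<phi> where "\<phi> = angle_at (w (d-2)) (w (d-1)) (w d)"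
    have \<phi>: "\<phi> = arccos (A / r)"
    proof -
      have "((w (d-1) - c) \<bullet> (w d - c)) / (norm (w (d-1) - c) * norm (w d - c)) = (A * A) / (A * r)"
        unfolding w1 w0 by (simp add: add.assoc nr nA[simplified] inner_add uv)
      also have "\<dots> = A / r" using AB by (simp del: mult_cancel_left)
      finally show ?thesis unfolding \<phi>_def angle_at_def w2 by simp
    qed
    have Ar: "0 < A / r" "A / r \<le> 1"
    proof -
      show "0 < A / r" using AB r by simp
      have "A\<^sup>2 \<le> r\<^sup>2" using r by simp
      then have "A \<le> r" using r(2) by (rule power2_le_imp_le[OF _ less_imp_le])
      then show "A / r \<le> 1" using r by simp
    qed
    have cos: "cos \<phi> = A / r" using Ar by (simp add: \<phi>)
    have phi0: "0 \<le> \<phi>" "\<phi> \<le> pi" using Ar by (auto simp: \<phi> arccos_lbound arccos_ubound)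
    have sin: "sin \<phi> = B / r"
    proof -
      have "(sin \<phi>)\<^sup>2 = (B / r)\<^sup>2"
      proof -
        have "B\<^sup>2 = r\<^sup>2 - A\<^sup>2" "r\<^sup>2 \<noteq> 0" using r by auto
        then show ?thesis by (simp add: sin_squared_eq cos power_divide diff_divide_distrib)
      qed
      then show ?thesis using sin_ge_zero[OF phi0] AB r by (simp add: power2_eq_iff_nonneg)
    qed
    have phi4: "\<phi> \<le> pi / 4"
    proof -
      have "r\<^sup>2 \<le> 2 * A\<^sup>2" using AB r(1) by (simp add: power2_eq_square mult_mono)
      then have "r\<^sup>2 \<le> (sqrt 2 * A)\<^sup>2" by (simp add: power_mult_distrib)
      then have "r \<le> sqrt 2 * A" by (rule power2_le_imp_le) (use AB in simp)
      then have "sqrt 2 * r \<le> sqrt 2 * (sqrt 2 * A)" by (intro mult_left_mono) auto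
      moreover have "sqrt 2 * (sqrt 2 * A) = 2 * A" by (simp flip: mult.assoc)
      ultimately have "sqrt 2 * r \<le> 2 * A" by metis
      then have "sqrt 2 / 2 \<le> A / r" using r by (simp add: field_simps)
      then have "cos (pi / 4) \<le> cos \<phi>" by (simp add: cos cos_45)
      then show ?thesis using cos_mono_le_eq[of "pi / 4" \<phi>] phi0 by simp
    qed
    have ang: "angle_at (w (d-2)) (w d) (w (d+1)) = pi / 4 - \<phi>"
    proof -
      have "angle_at (w (d-2)) (w d) (w (d+1)) = arccos ((A + B) * q / (r * r))"
        unfolding angle_at_def w2 w0 wq using nr nq
        by (simp add: add.assoc inner_add uv algebra_simps add_divide_distrib)
      also have "(A + B) * q / (r * r) = cos (pi / 4 - \<phi>)"
      proof -
        have "cos (pi / 4 - \<phi>) = (sqrt 2 / 2) * (A / r) + (sqrt 2 / 2) * (B / r)"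
          unfolding cos_diff cos sin cos_45 sin_45 ..
        moreover have "(A + B) * q / (r * r) = (A + B) / (sqrt 2 * r)"
          using r(2) by (simp add: q_def field_simps)
        moreover have "sqrt 2 / 2 = 1 / sqrt 2" by (simp add: real_div_sqrt field_simps)
        ultimately show ?thesis by (simp add: add_divide_distrib)
      qed
      also have "arccos (cos (pi / 4 - \<phi>)) = pi / 4 - \<phi>"
        using phi0 phi4 by (intro arccos_cos) auto
      finally show ?thesis .
    qed
    define n where "n = A *\<^sub>R v - B *\<^sub>R u"
    define b where "b = n \<bullet> c"
    have nu: "n \<bullet> u = - B" "n \<bullet> v = A" by (simp_all add: n_def inner_diff uv)
    have tri: "corner_triangle w
        = {c + (s + t) *\<^sub>R A *\<^sub>R u + t *\<^sub>R B *\<^sub>R v | s t. 0 \<le> s \<and> 0 \<le> t \<and> s + t \<le> 1}"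
      unfolding corner_triangle_def Let_def d_def[symmetric] w2 w1 w0 convex_hull_3_alt
      by (simp add: algebra_simps)
    have sec: "corner_sector w = cball c r \<inter>
        {c + s *\<^sub>R (A *\<^sub>R u + B *\<^sub>R v) + t *\<^sub>R q *\<^sub>R (u + v) | s t. 0 \<le> s \<and> 0 \<le> t}"
    proof -
      have "w d - c = A *\<^sub>R u + B *\<^sub>R v" by (simp add: w0)
      moreover from this have "dist c (w d) = r" using nr by (metis dist_commute dist_norm)
      moreover have "w (d+1) - c = q *\<^sub>R (u + v)" unfolding wq by simp
      ultimately show ?thesis
        unfolding corner_sector_def circular_sector_def Let_def d_def[symmetric] w2 by simp
    qed
    have seg: "closed_segment (w (d-2)) (w d) = {c + t *\<^sub>R (A *\<^sub>R u + B *\<^sub>R v) | t. 0 \<le> t \<and> t \<le> 1}"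
      unfolding closed_segment_def w2 w0 by (simp add: algebra_simps)
    have ntri: "n \<bullet> (c + (s + t) *\<^sub>R A *\<^sub>R u + t *\<^sub>R B *\<^sub>R v) = b - s * (A * B)" for s t
      by (simp add: inner_add nu b_def algebra_simps)
    have nsec: "n \<bullet> (c + s *\<^sub>R (A *\<^sub>R u + B *\<^sub>R v) + t *\<^sub>R q *\<^sub>R (u + v)) = b + t * (q * (A - B))" for s t
      by (simp add: inner_add nu b_def algebra_simps)
    have ltri: "n \<bullet> x \<le> b" if "x \<in> corner_triangle w" for x
    proof -
      obtain s t where st: "0 \<le> s" "x = c + (s + t) *\<^sub>R A *\<^sub>R u + t *\<^sub>R B *\<^sub>R v"
        using \<open>x \<in> corner_triangle w\<close> unfolding tri by blast
      show ?thesis unfolding st(2) ntri using st(1) AB by simp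
    qed
    have lsec: "b \<le> n \<bullet> x" if "x \<in> corner_sector w" for x
    proof -
      obtain s t where st: "0 \<le> t" "x = c + s *\<^sub>R (A *\<^sub>R u + B *\<^sub>R v) + t *\<^sub>R q *\<^sub>R (u + v)"
        using \<open>x \<in> corner_sector w\<close> unfolding sec by blast
      show ?thesis unfolding st(2) nsec using st(1) AB q by simp
    qed
    have int: "corner_triangle w \<inter> corner_sector w = closed_segment (w (d-2)) (w d)"
    proof
      show "corner_triangle w \<inter> corner_sector w \<subseteq> closed_segment (w (d-2)) (w d)"
      proof
        fix x assume x: "x \<in> corner_triangle w \<inter> corner_sector w"
        then obtain s t where st: "0 \<le> s" "0 \<le> t" "s + t \<le> 1"
          "x = c + (s + t) *\<^sub>R A *\<^sub>R u + t *\<^sub>R B *\<^sub>R v" unfolding tri by auto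
        have "b \<le> b - s * (A * B)" using lsec[of x] x ntri[of s t] st(4) by simp
        then have "s = 0" using st(1) AB by (auto simp: mult_le_0_iff)
        then show "x \<in> closed_segment (w (d-2)) (w d)"
          unfolding seg using st by (auto simp: scaleR_add_right add.assoc intro!: exI[of _ t])
      qed
      show "closed_segment (w (d-2)) (w d) \<subseteq> corner_triangle w \<inter> corner_sector w"
      proof
        fix x assume "x \<in> closed_segment (w (d-2)) (w d)"
        then obtain t where t: "0 \<le> t" "t \<le> 1" "x = c + t *\<^sub>R (A *\<^sub>R u + B *\<^sub>R v)"
          unfolding seg by auto
        have "x = c + (0 + t) *\<^sub>R A *\<^sub>R u + t *\<^sub>R B *\<^sub>R v"
          by (simp add: t(3) scaleR_add_right)
        moreover have "(0::real) \<le> 0" "0 + t \<le> 1" using t by auto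
        ultimately have "x \<in> corner_triangle w" unfolding tri using t(1) by blast
        moreover have "x \<in> cball c r"
          using t r nr by (simp add: dist_norm norm_minus_commute mult_left_le_one_le)
        moreover have "x = c + t *\<^sub>R (A *\<^sub>R u + B *\<^sub>R v) + 0 *\<^sub>R q *\<^sub>R (u + v)" by (simp add: t)
        ultimately show "x \<in> corner_triangle w \<inter> corner_sector w"
          unfolding sec using t(1) by blast
      qed
    qed
    let ?P = "affine hull {w (d-2), w (d-1), w d}"
    have P: "?P = {c + s *\<^sub>R u + t *\<^sub>R v | s t. True}"
    proof -
      have "c + s *\<^sub>R u + t *\<^sub>R v \<in> ?P" for s t
      proof -
        have "c + s *\<^sub>R u + t *\<^sub>R v
            = (1 - s / A) *\<^sub>R w (d-2) + (s / A - t / B) *\<^sub>R w (d-1) + (t / B) *\<^sub>R w d"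
          unfolding w2 w1 w0 using AB by (simp add: algebra_simps)
        moreover have "(1 - s / A) + (s / A - t / B) + t / B = 1" by simp
        ultimately show ?thesis unfolding affine_hull_3 by blast
      qed
      moreover have "x \<in> {c + s *\<^sub>R u + t *\<^sub>R v | s t. True}" if x: "x \<in> ?P" for x
      proof -
        obtain l m k where lm: "x = l *\<^sub>R w (d-2) + m *\<^sub>R w (d-1) + k *\<^sub>R w d" "l + m + k = 1"
          using x unfolding affine_hull_3 by auto
        have "x = (l + m + k) *\<^sub>R c + ((m + k) * A) *\<^sub>R u + (k * B) *\<^sub>R v"
          unfolding lm(1) w2 w1 w0 by (simp add: algebra_simps)
        then show ?thesis using lm(2) by auto
      qed
      ultimately show ?thesis by blast
    qed
    have inP: "w (d+1) \<in> ?P"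
      unfolding P wq scaleR_add_right add.assoc[symmetric] by blast
    have line: "?P \<inter> {x. n \<bullet> x = b} = affine hull {w (d-2), w d}"
    proof
      show "?P \<inter> {x. n \<bullet> x = b} \<subseteq> affine hull {w (d-2), w d}"
      proof
        fix x assume x: "x \<in> ?P \<inter> {x. n \<bullet> x = b}"
        then obtain s t where st: "x = c + s *\<^sub>R u + t *\<^sub>R v" unfolding P by auto
        have "t * A = s * B" using x unfolding st by (simp add: inner_add nu b_def)
        then have "t = s / A * B" using AB by (simp add: field_simps)
        then have "x = (1 - s / A) *\<^sub>R w (d-2) + (s / A) *\<^sub>R w d"
          unfolding st w2 w0 using AB by (simp add: algebra_simps)
        moreover have "(1 - s / A) + s / A = 1" by simp
        ultimately show "x \<in> affine hull {w (d-2), w d}"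
          unfolding affine_hull_2 by blast
      qed
      show "affine hull {w (d-2), w d} \<subseteq> ?P \<inter> {x. n \<bullet> x = b}"
      proof
        fix x assume "x \<in> affine hull {w (d-2), w d}"
        then obtain l m where lm: "x = l *\<^sub>R w (d-2) + m *\<^sub>R w d" "l + m = 1"
          unfolding affine_hull_2 by auto
        have "x = (l + m) *\<^sub>R c + (m * A) *\<^sub>R u + (m * B) *\<^sub>R v"
          unfolding lm(1) w2 w0 by (simp add: algebra_simps)
        then have x: "x = c + (m * A) *\<^sub>R u + (m * B) *\<^sub>R v" using lm(2) by simp
        have "n \<bullet> x = b" unfolding x by (simp add: inner_add nu b_def)
        then show "x \<in> ?P \<inter> {x. n \<bullet> x = b}" unfolding P using x by blast
      qed
    qed
    have "norm (w (d+1) - w (d-2)) = norm (w d - w (d-2))"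
      unfolding w2 wq w0 using nr nq by (simp add: add.assoc)
    then show ?thesis
      unfolding arc_endpoint_def Let_def d_def[symmetric] \<phi>_def[symmetric]
      using inP ang[unfolded \<phi>_def] int line ltri lsec \<phi>_def by blast
  qed
  ultimately show ?thesis by blast
qed

end

theory Submission
  imports Defs "HOL-Combinatorics.Multiset_Permutations"
begin

text \<open>The perpendicular bisectors of its edges cut the regular simplex into \<open>(d + 1)!\<close> congruent copies of
the orthoscheme \<open>O = conv {o, w 1, \<dots>, w d}\<close>. The points of one copy have a common nearest vertex, and
only the ball around this vertex matters there. So the density of the simplex is the density of the
unit ball in \<open>O\<close> (\<open>rogers_sigma_eq_orthoscheme\<close>). The body \<open>W\<close> consists of \<open>O\<close> and of a piece \<open>K\<close> over
the circular sector, and it remains to see that the unit ball is less dense in \<open>K\<close> than in \<open>O\<close>.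

Both \<open>O\<close> and \<open>K\<close> are joins of the simplex \<open>conv {o, w 1, \<dots>, w (d - 3)}\<close> with a planar set, a triangle or a
sector, that has \<open>w (d - 2)\<close> as a corner. The plane is orthogonal to \<open>w 1, \<dots>, w (d - 2)\<close>. Split these sets
by the direction \<open>\<theta>\<close> seen from \<open>w (d - 2)\<close> in the plane. In the direction \<open>\<theta>\<close> the planar set is a segment of
some length \<open>\<rho>\<close>. Stretching the plane away from \<open>w (d - 2)\<close> turns the slice for one length into the slice
for another one and moves points away from \<open>o\<close>, so the density of a slice is strictly decreasing in \<open>\<rho>\<close>.
In the sector \<open>\<rho>\<close> always has the value \<open>r\<close> that is its maximum over the triangle, and so \<open>K\<close> has the lower
density.

Slices have measure zero. The argument is therefore carried out for thin angular ranges, and instead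
of integrating in polar coordinates it uses only that both volumes are additive in the angular
range, that they do not change under rotations of the plane, and how they change under dilations of
the plane. Over a sector of fixed radius additivity and rotation invariance make both volumes
proportional to the angle (\<open>additive_imp_linear_on\<close>, \<open>sector_linear\<close>), so the density depends on the
radius alone, and by \<open>ball_vol_shrink_gt\<close> it strictly decreases. A thin piece of the triangle lies
between two sectors of almost equal radii. This gives the comparison of the triangle with the
sector of the largest radius up to a relative error proportional to the angle, and the error
disappears under repeated bisection of the angle (\<open>additive_comparison\<close>, \<open>truncated_cone_density_ge\<close>).
The comparison with a smaller radius on one half of the triangle makes the inequality strict
(\<open>sector_lowers_density\<close>).\<close>

section \<open>Measures of linear images\<close>

lemma measure_shear_cbox:
  fixes a b :: "real^'n"
  assumes mn: "m \<noteq> n"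
  defines "f \<equiv> \<lambda>x::real^'n. \<chi> i. if i = m then x$m + x$n else x$i"
  shows "measure lebesgue (f ` cbox a b) = measure lebesgue (cbox a b)"
proof (cases "cbox a b = {}")
  case False
  \<comment> \<open>\<open>measure_shear_interval\<close> wants the lower corner to have a nonnegative \<open>n\<close>-coordinate.\<close>
  define s where "s = axis n (a$n)"
  have lin: "f (x + y) = f x + f y" for x y
    by (simp add: f_def vec_eq_iff)
  have s: "(+) s ` cbox (a - s) (b - s) = cbox a b"
    using cbox_translation[of s "a - s" "b - s"] by simp
  then have "f ` cbox a b = f ` ((+) s ` cbox (a - s) (b - s))"
    by simp
  also have "\<dots> = (+) (f s) ` (f ` cbox (a - s) (b - s))"
    by (simp add: image_image lin)
  finally have "measure lebesgue (f ` cbox a b) = measure lebesgue (f ` cbox (a - s) (b - s))"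
    by (simp only: measure_translation)
  also have "\<dots> = measure lebesgue (cbox (a - s) (b - s))"
    unfolding f_def
  proof (rule measure_shear_interval[OF mn])
    show "cbox (a - s) (b - s) \<noteq> {}"
      using False by (simp add: interval_ne_empty_cart)
    show "0 \<le> (a - s) $ n" by (simp add: s_def)
  qed
  also have "\<dots> = measure lebesgue ((+) s ` cbox (a - s) (b - s))"
    by (simp only: measure_translation)
  finally show ?thesis by (simp only: s)
qed simp

lemma measure_swap_cbox:
  fixes a b :: "real^'n" and m n :: 'n
  defines "f \<equiv> \<lambda>x::real^'n. \<chi> i. x $ Transposition.transpose m n i"
  shows "measure lebesgue (f ` cbox a b) = measure lebesgue (cbox a b)"
proof (cases "cbox a b = {}")
  case False
  let ?t = "Transposition.transpose m n"
  have invol: "f (f x) = x" for x by (simp add: f_def vec_eq_iff)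
  have "f x \<in> cbox (f a) (f b)" if "x \<in> cbox a b" for x and a b
    using that by (simp add: f_def mem_box_cart)
  then have "f ` cbox a b \<subseteq> cbox (f a) (f b)" "f ` cbox (f a) (f b) \<subseteq> cbox (f (f a)) (f (f b))"
    by blast+
  then have eq: "f ` cbox a b = cbox (f a) (f b)"
    unfolding invol by (metis invol image_eqI subset_antisym subset_iff)
  have "(\<Prod>i\<in>UNIV. (b - a) $ ?t i) = (\<Prod>i\<in>UNIV. (b - a) $ i)"
    by (rule prod.reindex_bij_betw) (metis bij_transpose)
  moreover have "cbox (f a) (f b) \<noteq> {}" using False eq by auto
  ultimately show ?thesis
    using False by (simp add: eq content_cbox_cart) (simp add: f_def)
qed simp

lemma measure_factor_if_cbox:
  fixes f :: "real^'n \<Rightarrow> real^'n"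
  assumes "linear f" and "\<And>a b. measure lebesgue (f ` cbox a b) = measure lebesgue (cbox a b)"
  shows "\<exists>k\<ge>0. \<forall>S\<in>lmeasurable. f ` S \<in> lmeasurable \<and>
           measure lebesgue (f ` S) = k * measure lebesgue S"
proof -
  have "f ` S \<in> lmeasurable \<and> 1 * measure lebesgue S = measure lebesgue (f ` S)"
    if "S \<in> lmeasurable" for S
    by (rule measure_linear_sufficient[OF assms(1) that]) (simp only: assms(2) mult_1)
  note * = this
  show ?thesis
  proof (intro exI[of _ 1] conjI ballI)
    fix S :: "(real^'n) set"
    assume "S \<in> lmeasurable"
    then show "f ` S \<in> lmeasurable" "measure lebesgue (f ` S) = 1 * measure lebesgue S"
      using * by (blast, metis)
  qed simp
qed

text \<open>The value of \<open>k\<close> is the absolute value of the determinant, but a determinant needs no attention here: any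
factor that is the same for all sets can be found by testing it on a ball. Every linear map is a
composition of stretchings, coordinate swaps and shears, and singular maps.\<close>

lemma linear_image_measure_factor:
  fixes f :: "real^'n \<Rightarrow> real^'n"
  assumes "linear f"
  shows "\<exists>k\<ge>0. \<forall>S\<in>lmeasurable. f ` S \<in> lmeasurable \<and>
           measure lebesgue (f ` S) = k * measure lebesgue S"
proof (rule induct_linear_elementary[OF assms])
  fix f g :: "real^'n \<Rightarrow> real^'n"
  assume "\<exists>k\<ge>0. \<forall>S\<in>lmeasurable. f ` S \<in> lmeasurable \<and> measure lebesgue (f ` S) = k * measure lebesgue S"
    and "\<exists>k\<ge>0. \<forall>S\<in>lmeasurable. g ` S \<in> lmeasurable \<and> measure lebesgue (g ` S) = k * measure lebesgue S"
  then obtain k l where "k \<ge> 0" "l \<ge> 0"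
    and "\<And>S. S \<in> lmeasurable \<Longrightarrow> f ` S \<in> lmeasurable \<and> measure lebesgue (f ` S) = k * measure lebesgue S"
    and "\<And>S. S \<in> lmeasurable \<Longrightarrow> g ` S \<in> lmeasurable \<and> measure lebesgue (g ` S) = l * measure lebesgue S"
    by blast
  then show "\<exists>k\<ge>0. \<forall>S\<in>lmeasurable. (f \<circ> g) ` S \<in> lmeasurable \<and>
      measure lebesgue ((f \<circ> g) ` S) = k * measure lebesgue S"
    by (intro exI[of _ "k * l"]) (simp del: image_comp comp_apply add: image_comp[symmetric])
next
  fix f :: "real^'n \<Rightarrow> real^'n" and i
  assume f: "linear f" "\<And>x. f x $ i = 0"
  have "\<not> surj f" using f(2) by (metis one_neq_zero surjE vec_component)
  then have "\<not> inj f" using f(1) linear_injective_imp_surjective by blast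
  then have "negligible (f ` S)" for S
    using f(1) negligible_linear_singular_image by blast
  then show "\<exists>k\<ge>0. \<forall>S\<in>lmeasurable. f ` S \<in> lmeasurable \<and>
      measure lebesgue (f ` S) = k * measure lebesgue S"
    by (intro exI[of _ 0]) (auto simp: negligible_imp_measurable negligible_imp_measure0)
next
  fix c :: "'n \<Rightarrow> real"
  show "\<exists>k\<ge>0. \<forall>S\<in>lmeasurable. (\<lambda>x. \<chi> i. c i * x $ i) ` S \<in> lmeasurable \<and>
      measure lebesgue ((\<lambda>x. \<chi> i. c i * x $ i) ` S) = k * measure lebesgue S"
    by (intro exI[of _ "\<bar>prod c UNIV\<bar>"]) (simp add: measurable_stretch measure_stretch)
next
  fix m n :: 'n
  show "\<exists>k\<ge>0. \<forall>S\<in>lmeasurable. (\<lambda>x::real^'n. \<chi> i. x $ Transposition.transpose m n i) ` S \<in> lmeasurable \<and>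
      measure lebesgue ((\<lambda>x::real^'n. \<chi> i. x $ Transposition.transpose m n i) ` S) = k * measure lebesgue S"
    by (rule measure_factor_if_cbox) (auto intro!: linearI simp: vec_eq_iff measure_swap_cbox)
next
  fix m n :: 'n
  assume "m \<noteq> n"
  then show "\<exists>k\<ge>0. \<forall>S\<in>lmeasurable. (\<lambda>x::real^'n. \<chi> i. if i = m then x $ m + x $ n else x $ i) ` S \<in> lmeasurable \<and>
      measure lebesgue ((\<lambda>x::real^'n. \<chi> i. if i = m then x $ m + x $ n else x $ i) ` S) = k * measure lebesgue S"
    by (intro measure_factor_if_cbox measure_shear_cbox) (auto intro!: linearI simp: vec_eq_iff algebra_simps)
qed

text \<open>The unit ball is mapped onto itself, so the factor is \<open>1\<close>.\<close>

lemma measure_orthogonal_transformation_image: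
  fixes f :: "real^'n \<Rightarrow> real^'n"
  assumes f: "orthogonal_transformation f" and S: "S \<in> lmeasurable"
  shows "measure lebesgue (f ` S) = measure lebesgue S"
proof -
  have "linear f" using f by (rule orthogonal_transformation_linear)
  then obtain k where k: "k \<ge> 0" "\<forall>S\<in>lmeasurable. f ` S \<in> lmeasurable \<and>
           measure lebesgue (f ` S) = k * measure lebesgue S"
    using linear_image_measure_factor by blast
  have "f ` cball 0 1 = cball (f 0) 1"
    using f by (rule image_orthogonal_transformation_cball)
  also have "f 0 = 0" using \<open>linear f\<close> by (rule linear_0)
  finally have "measure lebesgue (cball 0 1 :: (real^'n) set) = k * measure lebesgue (cball 0 1 :: (real^'n) set)"
    using k(2) by (metis lmeasurable_cball)
  moreover have "measure lebesgue (cball 0 1 :: (real^'n) set) \<noteq> 0"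
    using content_cball_pos[of 1 "0 :: real^'n"] by simp
  ultimately have "k = 1" by simp
  then show ?thesis using k(2) S by simp
qed

section \<open>Additive functions of an interval\<close>

text \<open>Let \<open>h\<close> be the deviation of \<open>f\<close> from the linear function with the same value at \<open>M\<close>. If \<open>h\<close> is bounded by \<open>c\<close>,
then it is bounded by \<open>c / 2\<close>: for \<open>s \<le> M / 2\<close> because \<open>h (2 * s) = 2 * h s\<close>, and for larger \<open>s\<close> because
\<open>h s = - h (M - s)\<close>. So \<open>h = 0\<close>.\<close>

lemma additive_imp_linear_on:
  fixes f :: "real \<Rightarrow> real"
  assumes add: "\<And>s t. 0 < s \<Longrightarrow> 0 < t \<Longrightarrow> s + t \<le> M \<Longrightarrow> f (s + t) = f s + f t"
    and nonneg: "\<And>s. 0 < s \<Longrightarrow> s \<le> M \<Longrightarrow> 0 \<le> f s"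
    and t: "0 < t" "t \<le> M"
  shows "f t = t * (f M / M)"
proof -
  define h where "h s = f s - s * (f M / M)" for s
  have M: "M > 0" using t by simp
  have hadd: "h (s + s') = h s + h s'" if "0 < s" "0 < s'" "s + s' \<le> M" for s s'
    using add[OF that] by (simp add: h_def algebra_simps add_divide_distrib)
  have hM: "h M = 0" using M by (simp add: h_def)
  have halve: "\<bar>h s\<bar> \<le> f M / 2 ^ n" if "0 < s" "s \<le> M" for s n
    using that
  proof (induction n arbitrary: s)
    case 0
    show ?case
    proof (cases "s = M")
      case False
      have "f M = f s + f (M - s)" "0 \<le> f s" "0 \<le> f (M - s)"
        using add[of s "M - s"] nonneg[of s] nonneg[of "M - s"] 0 False by auto
      moreover have "s * f M \<le> M * f M" using 0 nonneg[of M] M by (intro mult_right_mono) auto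
      moreover have "0 \<le> s * f M" using 0 nonneg[of M] M by simp
      ultimately have "0 \<le> s * (f M / M)" "s * (f M / M) \<le> f M"
        using M by (auto simp: field_simps)
      then show ?thesis
        using \<open>f M = f s + f (M - s)\<close> \<open>0 \<le> f s\<close> \<open>0 \<le> f (M - s)\<close> unfolding h_def by simp
    qed (use hM nonneg[of M] M in simp)
  next
    case (Suc n)
    consider "2 * s \<le> M" | "M < 2 * s" "s < M" | "s = M" using Suc.prems by linarith
    then show ?case
    proof cases
      case 1
      then have "h (2 * s) = 2 * h s" using hadd[of s s] Suc.prems by simp
      then show ?thesis using Suc.IH[of "2 * s"] 1 Suc.prems by (simp add: abs_mult)
    next
      case 2
      let ?r = "M - s"
      have "h (2 * ?r) = 2 * h ?r" using hadd[of ?r ?r] 2 by simp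
      moreover have "h M = h s + h ?r" using hadd[of s ?r] 2 Suc.prems by simp
      ultimately show ?thesis using Suc.IH[of "2 * ?r"] 2 hM by (simp add: abs_mult)
    next
      case 3
      then show ?thesis using hM nonneg[of M] M by simp
    qed
  qed
  have "\<bar>h t\<bar> \<le> 0"
  proof (rule tendsto_lowerbound)
    show "(\<lambda>n. f M / 2 ^ n) \<longlonglongrightarrow> 0" by (simp add: LIMSEQ_divide_realpow_zero)
    show "\<forall>\<^sub>F n in sequentially. \<bar>h t\<bar> \<le> f M / 2 ^ n" using halve[OF t] by simp
  qed simp
  then show ?thesis by (simp add: h_def)
qed

text \<open>An integral-free comparison of two integrals: the local hypothesis allows an error of second order
in the length of the interval, and bisecting an interval halves the sum of these errors.\<close>

lemma additive_comparison:
  fixes a b :: "real \<Rightarrow> real \<Rightarrow> real"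
  assumes a: "\<And>x y z. lo \<le> x \<Longrightarrow> x < y \<Longrightarrow> y < z \<Longrightarrow> z \<le> hi \<Longrightarrow> a x z = a x y + a y z"
    and b: "\<And>x y z. lo \<le> x \<Longrightarrow> x < y \<Longrightarrow> y < z \<Longrightarrow> z \<le> hi \<Longrightarrow> b x z = b x y + b y z"
    and loc: "\<And>x y. lo \<le> x \<Longrightarrow> x < y \<Longrightarrow> y \<le> hi \<Longrightarrow> (1 - K * (y - x)) * a x y \<le> b x y"
    and "lo < hi"
  shows "a lo hi \<le> b lo hi"
proof -
  have "(1 - K * (y - x) / 2 ^ n) * a x y \<le> b x y" if "lo \<le> x" "x < y" "y \<le> hi" for x y n
    using that
  proof (induction n arbitrary: x y)
    case 0
    then show ?case using loc by simp
  next
    case (Suc n)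
    define m where "m = (x + y) / 2"
    define c where "c = 1 - K * (y - x) / 2 ^ Suc n"
    have m: "x < m" "m < y" "lo \<le> m" "m \<le> hi" using Suc.prems by (auto simp: m_def)
    have "1 - K * (m - x) / 2 ^ n = c" "1 - K * (y - m) / 2 ^ n = c"
      by (simp_all add: c_def m_def field_simps)
    then have "c * a x m \<le> b x m" "c * a m y \<le> b m y"
      using Suc.IH[of x m] Suc.IH[of m y] Suc.prems m by simp_all
    then show ?case
      unfolding c_def[symmetric] using a[of x m y] b[of x m y] Suc.prems m by (simp add: distrib_left)
  qed
  then have *: "(1 - K * (hi - lo) / 2 ^ n) * a lo hi \<le> b lo hi" for n
    using \<open>lo < hi\<close> by simp
  have "(\<lambda>n. (1 - K * (hi - lo) / 2 ^ n) * a lo hi) \<longlonglongrightarrow> (1 - 0) * a lo hi"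
    by (intro tendsto_intros LIMSEQ_divide_realpow_zero) auto
  then have "(\<lambda>n. (1 - K * (hi - lo) / 2 ^ n) * a lo hi) \<longlonglongrightarrow> a lo hi" by simp
  then show ?thesis by (rule tendsto_upperbound) (use * in auto)
qed

section \<open>Angular cones in the complex plane\<close>

text \<open>For \<open>\<alpha> < \<beta> < \<alpha> + pi\<close> this is the cone of the complex numbers with an argument between \<open>\<alpha>\<close> and \<open>\<beta>\<close>. As an
intersection of two half-planes it is visibly convex, and turning it only shifts \<open>\<alpha>\<close> and \<open>\<beta>\<close>.\<close>

definition angular_cone :: "real \<Rightarrow> real \<Rightarrow> complex set" where
  "angular_cone \<alpha> \<beta> = {z. 0 \<le> Im (z * cis (- \<alpha>)) \<and> Im (z * cis (- \<beta>)) \<le> 0}"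

text \<open>For \<open>z = cis \<theta>\<close> this is the linear dependence between the sines of \<open>\<theta> - \<alpha>\<close>, \<open>\<theta> - \<beta>\<close> and \<open>\<theta> - \<gamma>\<close>.\<close>

lemma Im_cis_three_angles:
  "sin (\<beta> - \<alpha>) * Im (z * cis (- \<gamma>)) =
   sin (\<gamma> - \<alpha>) * Im (z * cis (- \<beta>)) - sin (\<gamma> - \<beta>) * Im (z * cis (- \<alpha>))"
  by (simp add: sin_diff algebra_simps)

lemma angular_cone_split:
  assumes "\<alpha> < \<beta>" "\<beta> < \<gamma>" "\<gamma> < \<alpha> + pi"
  shows "angular_cone \<alpha> \<gamma> = angular_cone \<alpha> \<beta> \<union> angular_cone \<beta> \<gamma>"
proof -
  have s: "0 < sin (\<beta> - \<alpha>)" "0 < sin (\<gamma> - \<beta>)" "0 < sin (\<gamma> - \<alpha>)"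
    using assms by (auto intro!: sin_gt_zero)
  have "Im (z * cis (- \<gamma>)) \<le> 0"
    if "0 \<le> Im (z * cis (- \<alpha>))" "Im (z * cis (- \<beta>)) \<le> 0" for z
  proof -
    have "sin (\<gamma> - \<alpha>) * Im (z * cis (- \<beta>)) \<le> 0" "0 \<le> sin (\<gamma> - \<beta>) * Im (z * cis (- \<alpha>))"
      using that s by (auto simp: mult_le_0_iff)
    then have "sin (\<beta> - \<alpha>) * Im (z * cis (- \<gamma>)) \<le> 0"
      using Im_cis_three_angles[of \<beta> \<alpha> z \<gamma>] by linarith
    then show ?thesis using s by (auto simp: mult_le_0_iff)
  qed
  moreover have "0 \<le> Im (z * cis (- \<alpha>))"
    if "Im (z * cis (- \<gamma>)) \<le> 0" "0 \<le> Im (z * cis (- \<beta>))" for z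
  proof -
    have "0 \<le> sin (\<gamma> - \<alpha>) * Im (z * cis (- \<beta>))" "sin (\<beta> - \<alpha>) * Im (z * cis (- \<gamma>)) \<le> 0"
      using that s by (auto simp: mult_le_0_iff)
    then have "0 \<le> sin (\<gamma> - \<beta>) * Im (z * cis (- \<alpha>))"
      using Im_cis_three_angles[of \<beta> \<alpha> z \<gamma>] by linarith
    then show ?thesis using s by (auto simp: zero_le_mult_iff)
  qed
  ultimately show ?thesis unfolding angular_cone_def by fastforce
qed

lemma angular_cone_Int_subset:
  "angular_cone \<alpha> \<beta> \<inter> angular_cone \<beta> \<gamma> \<subseteq> {z. Im (z * cis (- \<beta>)) = 0}"
  unfolding angular_cone_def by auto

lemma angular_cone_scaleR: "z \<in> angular_cone \<alpha> \<beta> \<Longrightarrow> 0 \<le> t \<Longrightarrow> t *\<^sub>R z \<in> angular_cone \<alpha> \<beta>"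
  unfolding angular_cone_def mem_Collect_eq mult_scaleR_left scaleR_complex.sel
  by (simp add: mult_le_0_iff del: times_complex.sel)

lemma zero_in_angular_cone [simp]: "0 \<in> angular_cone \<alpha> \<beta>"
  unfolding angular_cone_def by simp

lemma angular_cone_rotate:
  "(*) (cis \<tau>) ` angular_cone \<alpha> \<beta> = angular_cone (\<alpha> + \<tau>) (\<beta> + \<tau>)"
proof -
  have 1: "cis \<tau> * z * cis (- (\<alpha> + \<tau>)) = z * cis (- \<alpha>)" for z \<alpha>
    by (simp add: cis_mult mult.commute[of "cis \<tau>"] mult.assoc)
  have 2: "z = cis \<tau> * (z * cis (- \<tau>))" for z
    by (simp add: cis_mult mult.commute[of "cis \<tau>"] mult.assoc)
  have 3: "z * cis (- \<tau>) * cis (- \<alpha>) = z * cis (- (\<alpha> + \<tau>))" for z \<alpha>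
    by (simp add: cis_mult mult.assoc add.commute)
  have "z \<in> (*) (cis \<tau>) ` angular_cone \<alpha> \<beta>" if "z \<in> angular_cone (\<alpha> + \<tau>) (\<beta> + \<tau>)" for z
  proof (rule image_eqI)
    show "z = cis \<tau> * (z * cis (- \<tau>))" by (rule 2)
    show "z * cis (- \<tau>) \<in> angular_cone \<alpha> \<beta>"
      using that unfolding angular_cone_def mem_Collect_eq 3 .
  qed
  moreover have "cis \<tau> * z \<in> angular_cone (\<alpha> + \<tau>) (\<beta> + \<tau>)" if "z \<in> angular_cone \<alpha> \<beta>" for z
    using that unfolding angular_cone_def mem_Collect_eq 1 .
  ultimately show ?thesis by blast
qed

lemma convex_angular_cone: "convex (angular_cone \<alpha> \<beta>)"
proof -
  have l: "linear (\<lambda>z. Im (z * cis x))" for x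
    by (rule linearI) (auto simp: algebra_simps)
  have "convex ((\<lambda>z. Im (z * cis (- \<alpha>))) -` {0..} \<inter> (\<lambda>z. Im (z * cis (- \<beta>))) -` {..0})"
    by (intro convex_Int convex_linear_vimage[OF l]) auto
  then show ?thesis by (simp add: angular_cone_def vimage_def Collect_conj_eq)
qed

section \<open>Joins with a planar set\<close>

text \<open>The plane through \<open>c\<close> spanned by \<open>u\<close> and \<open>v\<close> is identified with the complex numbers, with \<open>c\<close> as origin. It is
orthogonal to \<open>c\<close> and to \<open>H\<close>, so multiplication by a complex number extends to the whole space such that
\<open>H\<close> and \<open>c\<close> are fixed (\<open>plane_mult\<close>). This treats rotations and dilations of the plane alike.\<close>

locale planar_join =
  fixes H :: "(real^'n) set" and c u v :: "real^'n"
  assumes H: "convex H" "bounded H" "0 \<in> H"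
    and H_orth: "\<And>h. h \<in> H \<Longrightarrow> h \<bullet> u = 0" "\<And>h. h \<in> H \<Longrightarrow> h \<bullet> v = 0"
    and c_orth: "c \<bullet> u = 0" "c \<bullet> v = 0"
    and uv: "u \<bullet> u = 1" "v \<bullet> v = 1" "u \<bullet> v = 0"
begin

definition pt :: "complex \<Rightarrow> real^'n" where
  "pt z = Re z *\<^sub>R u + Im z *\<^sub>R v"

definition proj :: "real^'n \<Rightarrow> complex" where
  "proj x = Complex (x \<bullet> u) (x \<bullet> v)"

definition join :: "complex set \<Rightarrow> (real^'n) set" where
  "join E = {(1 - t) *\<^sub>R h + t *\<^sub>R (c + pt z) | t h z. 0 \<le> t \<and> t \<le> 1 \<and> h \<in> H \<and> z \<in> E}"

definition plane_mult :: "complex \<Rightarrow> real^'n \<Rightarrow> real^'n" where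
  "plane_mult k x = x + pt ((k - 1) * proj x)"

definition vol :: "complex set \<Rightarrow> real" where
  "vol E = measure lebesgue (join E)"

definition ball_vol :: "complex set \<Rightarrow> real" where
  "ball_vol E = measure lebesgue (join E \<inter> cball 0 1)"

lemma vu: "v \<bullet> u = 0" using uv by (simp add: inner_commute)

lemma linear_pt: "linear pt"
  by (rule linearI) (auto simp: pt_def algebra_simps)

lemma linear_proj: "linear proj"
  by (rule linearI) (auto simp: proj_def complex_eq_iff inner_add_left)

lemma proj_pt [simp]: "proj (pt z) = z"
  by (simp add: proj_def pt_def inner_add_left uv vu complex_eq_iff)

lemma proj_H [simp]: "h \<in> H \<Longrightarrow> proj h = 0"
  by (simp add: proj_def H_orth complex_eq_iff)

lemma proj_c [simp]: "proj c = 0"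
  by (simp add: proj_def c_orth complex_eq_iff)

lemma proj_join_point:
  "h \<in> H \<Longrightarrow> proj ((1 - t) *\<^sub>R h + t *\<^sub>R (c + pt z)) = t *\<^sub>R z"
  by (simp add: linear_add[OF linear_proj] linear_scale[OF linear_proj])

lemma linear_plane_mult: "linear (plane_mult k)"
proof -
  have "linear (\<lambda>x. (k - 1) * proj x)"
    using linear_proj by (auto intro!: linearI simp: linear_add linear_scale algebra_simps)
  then show ?thesis
    unfolding plane_mult_def using linear_compose[OF _ linear_pt, of "\<lambda>x. (k - 1) * proj x"]
    by (intro linear_compose_add linear_id[unfolded id_def]) (auto simp: o_def)
qed

lemma plane_mult_pt: "plane_mult k (pt z) = pt (k * z)"
  by (simp add: plane_mult_def linear_add[OF linear_pt, symmetric] algebra_simps)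

lemma plane_mult_join: "plane_mult k ` join E = join ((*) k ` E)"
proof -
  have "plane_mult k c = c" "\<And>h. h \<in> H \<Longrightarrow> plane_mult k h = h"
    by (simp_all add: plane_mult_def linear_0[OF linear_pt])
  then have *: "plane_mult k ((1 - t) *\<^sub>R h + t *\<^sub>R (c + pt z)) = (1 - t) *\<^sub>R h + t *\<^sub>R (c + pt (k * z))"
    if "h \<in> H" for t h z
    using that by (simp add: linear_add[OF linear_plane_mult] linear_scale[OF linear_plane_mult] plane_mult_pt)
  show ?thesis
  proof
    show "plane_mult k ` join E \<subseteq> join ((*) k ` E)"
      unfolding join_def using * by blast
    show "join ((*) k ` E) \<subseteq> plane_mult k ` join E"
    proof
      fix x assume "x \<in> join ((*) k ` E)"
      then obtain t h z where "0 \<le> t" "t \<le> 1" "h \<in> H" "z \<in> E"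
        "x = (1 - t) *\<^sub>R h + t *\<^sub>R (c + pt (k * z))"
        unfolding join_def by blast
      then show "x \<in> plane_mult k ` join E"
        unfolding join_def by (intro image_eqI[of _ _ "(1 - t) *\<^sub>R h + t *\<^sub>R (c + pt z)"]) (auto simp: *)
    qed
  qed
qed

text \<open>By Pythagoras, since only the orthogonal projection to the plane is multiplied by \<open>k\<close>.\<close>

lemma norm_plane_mult:
  "(norm (plane_mult k x))\<^sup>2 = (norm x)\<^sup>2 + ((norm k)\<^sup>2 - 1) * (norm (proj x))\<^sup>2"
proof -
  have pt_inner: "x \<bullet> pt z = Re z * (x \<bullet> u) + Im z * (x \<bullet> v)" for z
    by (simp add: pt_def inner_add_right)
  have "pt z \<bullet> pt z = (Re z)\<^sup>2 + (Im z)\<^sup>2" for z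
    by (simp add: pt_def inner_add_left inner_add_right uv vu power2_eq_square)
  then show ?thesis
    unfolding cmod_power2 power2_norm_eq_inner[of x] power2_norm_eq_inner[of "plane_mult k x"]
    unfolding plane_mult_def
    by (simp add: inner_add_left inner_add_right pt_inner inner_commute[of "pt _" x])
      (simp add: proj_def power2_eq_square algebra_simps)
qed

lemma norm_plane_mult_le:
  assumes "norm k \<le> 1"
  shows "norm (plane_mult k x) \<le> norm x"
proof -
  have "((norm k)\<^sup>2 - 1) * (norm (proj x))\<^sup>2 \<le> 0"
    using assms by (intro mult_nonpos_nonneg) (auto simp: power_le_one)
  then have "(norm (plane_mult k x))\<^sup>2 \<le> (norm x)\<^sup>2" by (simp add: norm_plane_mult)
  then show ?thesis by (rule power2_le_imp_le) simp
qed

lemma norm_plane_mult_ge: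
  assumes "norm k \<le> 1"
  shows "norm k * norm x \<le> norm (plane_mult k x)"
proof -
  have "(norm (proj x))\<^sup>2 \<le> (norm x)\<^sup>2"
    using norm_plane_mult[of 0 x] zero_le_power2[of "norm (plane_mult 0 x)"] by simp
  then have "(1 - (norm k)\<^sup>2) * (norm (proj x))\<^sup>2 \<le> (1 - (norm k)\<^sup>2) * (norm x)\<^sup>2"
    using assms by (intro mult_left_mono) (auto simp: power_le_one)
  then have "(norm k * norm x)\<^sup>2 \<le> (norm (plane_mult k x))\<^sup>2"
    by (simp add: norm_plane_mult algebra_simps)
  then show ?thesis by (rule power2_le_imp_le) simp
qed

lemma plane_mult_inverse:
  assumes "k \<noteq> 0"
  shows "plane_mult (inverse k) (plane_mult k x) = x" "plane_mult k (plane_mult (inverse k) x) = x"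
proof -
  have *: "plane_mult l (plane_mult k x) = x" if "l * k = 1" for k l x
  proof -
    have "proj (plane_mult k x) = k * proj x"
      by (simp add: plane_mult_def linear_add[OF linear_proj] algebra_simps)
    then have "plane_mult l (plane_mult k x) = x + (pt ((k - 1) * proj x) + pt ((l - 1) * (k * proj x)))"
      by (simp add: plane_mult_def)
    also have "pt ((k - 1) * proj x) + pt ((l - 1) * (k * proj x)) = pt ((l * k - 1) * proj x)"
      by (simp add: linear_add[OF linear_pt, symmetric] algebra_simps)
    finally show ?thesis using that by (simp add: linear_0[OF linear_pt])
  qed
  show "plane_mult (inverse k) (plane_mult k x) = x" "plane_mult k (plane_mult (inverse k) x) = x"
    using * assms by simp_all
qed

lemma inj_plane_mult: "k \<noteq> 0 \<Longrightarrow> inj (plane_mult k)"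
  by (metis injI plane_mult_inverse(1))

definition factor :: "complex \<Rightarrow> real" where
  "factor k = (SOME a. a \<ge> 0 \<and> (\<forall>S\<in>lmeasurable. plane_mult k ` S \<in> lmeasurable \<and>
       measure lebesgue (plane_mult k ` S) = a * measure lebesgue S))"

lemma factor:
  "factor k \<ge> 0"
  "S \<in> lmeasurable \<Longrightarrow> plane_mult k ` S \<in> lmeasurable"
  "S \<in> lmeasurable \<Longrightarrow> measure lebesgue (plane_mult k ` S) = factor k * measure lebesgue S"
proof -
  have "factor k \<ge> 0 \<and> (\<forall>S\<in>lmeasurable. plane_mult k ` S \<in> lmeasurable \<and>
       measure lebesgue (plane_mult k ` S) = factor k * measure lebesgue S)"
    unfolding factor_def using linear_image_measure_factor[OF linear_plane_mult[of k]]
    by (rule someI_ex[unfolded Bex_def])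
  then show "factor k \<ge> 0"
    "S \<in> lmeasurable \<Longrightarrow> plane_mult k ` S \<in> lmeasurable"
    "S \<in> lmeasurable \<Longrightarrow> measure lebesgue (plane_mult k ` S) = factor k * measure lebesgue S"
    by blast+
qed

text \<open>In fact \<open>factor k = (norm k)\<^sup>2\<close>. Below it only matters that \<open>factor k\<close> is close to \<open>1\<close> for \<open>norm k\<close> close to \<open>1\<close>,
and this follows from comparing the image of the unit ball with the ball itself and with the
concentric ball of radius \<open>norm k\<close>.\<close>

lemma factor_bounds:
  assumes "norm k \<le> 1" "k \<noteq> 0"
  shows "norm k ^ CARD('n) \<le> factor k" "factor k \<le> 1"
proof -
  let ?B = "cball 0 1 :: (real^'n) set"
  have pos: "measure lebesgue ?B > 0" using content_cball_pos[of 1 "0 :: real^'n"] by simp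
  have "plane_mult k ` ?B \<subseteq> ?B"
    using order_trans[OF norm_plane_mult_le[OF assms(1)]] by auto
  then have "measure lebesgue (plane_mult k ` ?B) \<le> measure lebesgue ?B"
    using factor(2)[of ?B k] by (intro measure_mono_fmeasurable) auto
  then show "factor k \<le> 1" using pos by (simp add: factor(3))
  have "(\<lambda>x. norm k *\<^sub>R x + 0) ` ?B \<subseteq> plane_mult k ` ?B"
  proof safe
    fix x :: "real^'n" assume x: "x \<in> ?B"
    define y where "y = plane_mult (inverse k) (norm k *\<^sub>R x + 0)"
    have y: "plane_mult k y = norm k *\<^sub>R x + 0" by (simp only: y_def plane_mult_inverse(2)[OF assms(2)])
    have "norm k * norm y \<le> norm k * norm x"
      using norm_plane_mult_ge[OF assms(1), of y] by (simp add: y)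
    then have "norm y \<le> 1" using x assms(2) by simp
    then show "norm k *\<^sub>R x + 0 \<in> plane_mult k ` ?B" using y by (metis image_eqI mem_cball_0)
  qed
  then have "measure lebesgue ((\<lambda>x. norm k *\<^sub>R x + 0) ` ?B) \<le> measure lebesgue (plane_mult k ` ?B)"
    using factor(2)[of ?B k] measurable_convex[of "(\<lambda>x. norm k *\<^sub>R x) ` ?B"]
    by (intro measure_mono_fmeasurable) (auto simp: convex_scaling bounded_scaling)
  then have "norm k ^ CARD('n) * measure lebesgue ?B \<le> factor k * measure lebesgue ?B"
    using measure_lebesgue_affine[of "norm k" 0 ?B] by (simp add: factor(3))
  then show "norm k ^ CARD('n) \<le> factor k" using pos by simp
qed

lemma factor_1: "norm k = 1 \<Longrightarrow> factor k = 1"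
  using factor_bounds[of k] by force

lemma factor_pos: "k \<noteq> 0 \<Longrightarrow> norm k \<le> 1 \<Longrightarrow> factor k > 0"
  using factor_bounds(1)[of k] by (smt (verit) zero_less_norm_iff zero_less_power)

lemma join_mono: "E \<subseteq> E' \<Longrightarrow> join E \<subseteq> join E'"
  unfolding join_def by blast

lemma join_Un: "join (E \<union> E') = join E \<union> join E'"
  unfolding join_def by blast

lemma join_eq_convex_hull:
  assumes "convex E" "E \<noteq> {}"
  shows "join E = convex hull (H \<union> (\<lambda>z. c + pt z) ` E)"
proof -
  have "convex ((\<lambda>z. c + pt z) ` E)"
    using convex_translation[OF convex_linear_image[OF linear_pt assms(1)], of c] by (simp add: image_image)
  then have "convex hull (H \<union> (\<lambda>z. c + pt z) ` E) =
      {a *\<^sub>R s + b *\<^sub>R t | a b s t. a \<ge> 0 \<and> b \<ge> 0 \<and> a + b = 1 \<and> s \<in> H \<and> t \<in> (\<lambda>z. c + pt z) ` E}"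
    using H assms(2) by (intro convex_hull_union_two) auto
  also have "\<dots> = join E"
  proof (intro set_eqI iffI)
    fix x assume "x \<in> {a *\<^sub>R s + b *\<^sub>R t | a b s t. a \<ge> 0 \<and> b \<ge> 0 \<and> a + b = 1 \<and> s \<in> H \<and> t \<in> (\<lambda>z. c + pt z) ` E}"
    then obtain a b s z where *: "a \<ge> 0" "b \<ge> 0" "a + b = 1" "s \<in> H" "z \<in> E" "x = a *\<^sub>R s + b *\<^sub>R (c + pt z)"
      by blast
    moreover have "a = 1 - b" "b \<le> 1" using * by auto
    ultimately show "x \<in> join E" unfolding join_def by blast
  next
    fix x assume "x \<in> join E"
    then obtain t h z where *: "0 \<le> t" "t \<le> 1" "h \<in> H" "z \<in> E" "x = (1 - t) *\<^sub>R h + t *\<^sub>R (c + pt z)"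
      unfolding join_def by blast
    moreover have "1 - t \<ge> 0" "(1 - t) + t = 1" using * by auto
    ultimately show "x \<in> {a *\<^sub>R s + b *\<^sub>R t | a b s t. a \<ge> 0 \<and> b \<ge> 0 \<and> a + b = 1 \<and> s \<in> H \<and> t \<in> (\<lambda>z. c + pt z) ` E}"
      by blast
  qed
  finally show ?thesis by simp
qed

lemma convex_join: "convex E \<Longrightarrow> convex (join E)"
  by (cases "E = {}") (simp_all add: join_eq_convex_hull, simp add: join_def)

lemma bounded_join:
  assumes "bounded E"
  shows "bounded (join E)"
proof -
  have "bounded (pt ` E)"
    using assms linear_pt by (intro bounded_linear_image) (simp_all add: linear_linear)
  then have "bounded ((\<lambda>z. c + pt z) ` E)"
    using bounded_translation[of "pt ` E" c] by (simp add: image_image)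
  then have "bounded (convex hull (H \<union> (\<lambda>z. c + pt z) ` E))"
    using H by (simp add: bounded_convex_hull)
  moreover have "join E \<subseteq> convex hull (H \<union> (\<lambda>z. c + pt z) ` E)"
  proof
    fix x assume "x \<in> join E"
    then obtain t h z where *: "0 \<le> t" "t \<le> 1" "h \<in> H" "z \<in> E" "x = (1 - t) *\<^sub>R h + t *\<^sub>R (c + pt z)"
      unfolding join_def by blast
    show "x \<in> convex hull (H \<union> (\<lambda>z. c + pt z) ` E)"
      unfolding *(5) using *(1-4)
      by (intro convexD_alt[of "convex hull (H \<union> (\<lambda>z. c + pt z) ` E)"] convex_convex_hull hull_inc) auto
  qed
  ultimately show ?thesis by (rule bounded_subset)
qed

lemma lmeasurable_join:
  assumes "convex E" "bounded E"
  shows "join E \<in> lmeasurable" "join E \<inter> cball 0 1 \<in> lmeasurable"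
  using assms convex_join bounded_join by (auto intro!: measurable_convex simp: convex_Int bounded_Int)

lemma vol_nonneg: "0 \<le> vol E" and ball_vol_nonneg: "0 \<le> ball_vol E"
  by (simp_all add: vol_def ball_vol_def)

lemma vol_mono:
  assumes "E \<subseteq> E'" "convex E" "bounded E" "convex E'" "bounded E'"
  shows "vol E \<le> vol E'" "ball_vol E \<le> ball_vol E'"
  unfolding vol_def ball_vol_def using lmeasurable_join join_mono[OF assms(1)] assms
  by (auto intro!: measure_mono_fmeasurable simp: fmeasurableD)

lemma vol_mult:
  assumes "convex E" "bounded E"
  shows "vol ((*) k ` E) = factor k * vol E"
  using lmeasurable_join[OF assms] by (simp add: vol_def plane_mult_join[symmetric] factor(3))

text \<open>Contracting the plane towards its origin brings points closer to \<open>0\<close>: what was in the unit ball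
stays in it.\<close>

lemma ball_vol_mult_ge:
  assumes "convex E" "bounded E" "norm k \<le> 1"
  shows "factor k * ball_vol E \<le> ball_vol ((*) k ` E)"
proof -
  have sub: "plane_mult k ` (join E \<inter> cball 0 1) \<subseteq> join ((*) k ` E) \<inter> cball 0 1"
  proof -
    have "plane_mult k x \<in> cball 0 1" if "x \<in> cball 0 1" for x
      using norm_plane_mult_le[OF assms(3), of x] that by simp
    then show ?thesis unfolding plane_mult_join[symmetric] by blast
  qed
  have m: "convex ((*) k ` E)" "bounded ((*) k ` E)"
    using assms convex_linear_image[OF bounded_linear.linear[OF bounded_linear_mult_right]]
      bounded_linear_image[OF _ bounded_linear_mult_right] by blast+
  show ?thesis
    unfolding ball_vol_def factor(3)[OF lmeasurable_join(2)[OF assms(1,2)], symmetric]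
    using sub lmeasurable_join(2)[OF m] factor(2)[OF lmeasurable_join(2)[OF assms(1,2)], of k]
    by (intro measure_mono_fmeasurable) (auto simp: fmeasurableD)
qed

lemma ball_vol_rotate:
  assumes "convex E" "bounded E" "norm k = 1"
  shows "ball_vol ((*) k ` E) = ball_vol E"
proof -
  have nrm: "norm (plane_mult k x) = norm x" for x
    using norm_plane_mult[of k x] assms(3) by simp
  have "join ((*) k ` E) \<inter> cball 0 1 = plane_mult k ` (join E \<inter> cball 0 1)"
    unfolding plane_mult_join[symmetric] using nrm by auto
  then show ?thesis
    using factor(3)[OF lmeasurable_join(2)[OF assms(1,2)], of k] factor_1[OF assms(3)]
    by (simp add: ball_vol_def)
qed

end

section \<open>Sectors and truncated cones\<close>

definition sector :: "real \<Rightarrow> real \<Rightarrow> real \<Rightarrow> complex set" where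
  "sector \<alpha> \<beta> \<rho> = angular_cone \<alpha> \<beta> \<inter> cball 0 \<rho>"

text \<open>For \<open>0 < a\<close>, \<open>\<alpha> = 0\<close> and \<open>0 < \<beta> < pi / 2\<close> this is the right triangle with legs on the real axis and on the line
\<open>Re z = a\<close>; the other values of \<open>\<alpha>\<close> describe the pieces into which it is cut by rays from \<open>0\<close>.\<close>

definition truncated_cone :: "real \<Rightarrow> real \<Rightarrow> real \<Rightarrow> complex set" where
  "truncated_cone \<alpha> \<beta> a = angular_cone \<alpha> \<beta> \<inter> {z. Re z \<le> a}"

lemma convex_sector: "convex (sector \<alpha> \<beta> \<rho>)" and bounded_sector: "bounded (sector \<alpha> \<beta> \<rho>)"
  by (simp_all add: sector_def convex_Int convex_angular_cone bounded_Int)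

lemma convex_truncated_cone: "convex (truncated_cone \<alpha> \<beta> a)"
  unfolding truncated_cone_def by (intro convex_Int convex_angular_cone convex_halfspace_Re_le)

lemma sector_rotate: "(*) (cis \<tau>) ` sector \<alpha> \<beta> \<rho> = sector (\<alpha> + \<tau>) (\<beta> + \<tau>) \<rho>"
proof -
  have inj: "inj ((*) (cis \<tau>))" by (simp add: inj_def)
  have "w \<in> (*) (cis \<tau>) ` cball 0 \<rho>" if "w \<in> cball 0 \<rho>" for w
    using that by (intro image_eqI[where x = "cis (- \<tau>) * w"]) (simp_all add: cis_mult norm_mult flip: mult.assoc)
  then have "(*) (cis \<tau>) ` cball 0 \<rho> = cball 0 \<rho>"
    by (auto simp: norm_mult)
  then show ?thesis
    unfolding sector_def by (simp add: image_Int[OF inj] angular_cone_rotate)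
qed

lemma sector_scale:
  assumes "0 < t"
  shows "(*) (complex_of_real t) ` sector \<alpha> \<beta> \<rho> = sector \<alpha> \<beta> (t * \<rho>)"
proof -
  have "z \<in> (*) (complex_of_real t) ` sector \<alpha> \<beta> \<rho>" if "z \<in> sector \<alpha> \<beta> (t * \<rho>)" for z
  proof (rule image_eqI)
    show "z = complex_of_real t * ((1 / t) *\<^sub>R z)" using assms by (simp add: scaleR_conv_of_real)
    show "(1 / t) *\<^sub>R z \<in> sector \<alpha> \<beta> \<rho>"
      using that assms angular_cone_scaleR[of z \<alpha> \<beta> "1 / t"] by (simp add: sector_def field_simps)
  qed
  moreover have "complex_of_real t * z \<in> sector \<alpha> \<beta> (t * \<rho>)" if "z \<in> sector \<alpha> \<beta> \<rho>" for z
    using that assms angular_cone_scaleR[of z \<alpha> \<beta> t]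
    by (simp add: sector_def norm_mult scaleR_conv_of_real)
  ultimately show ?thesis by blast
qed

lemma angular_cone_0_subset:
  assumes "0 \<le> \<alpha>" "\<alpha> < \<beta>" "\<beta> < pi"
  shows "angular_cone \<alpha> \<beta> \<subseteq> angular_cone 0 \<beta>"
  using angular_cone_split[of 0 \<alpha> \<beta>] assms by (cases "\<alpha> = 0") auto

text \<open>In a direction \<open>\<theta>\<close> the truncated cone is a segment of length \<open>a / cos \<theta>\<close>, which increases with \<open>\<theta>\<close>. So the
extreme directions give the inscribed and the circumscribed sector.\<close>

lemma sector_subset_truncated_cone:
  assumes "0 \<le> \<alpha>" "\<alpha> < pi / 2"
  shows "sector \<alpha> \<beta> (a / cos \<alpha>) \<subseteq> truncated_cone \<alpha> \<beta> a"
proof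
  fix z assume z: "z \<in> sector \<alpha> \<beta> (a / cos \<alpha>)"
  define w where "w = z * cis (- \<alpha>)"
  have c: "0 < cos \<alpha>" and s: "0 \<le> sin \<alpha>" using assms by (auto intro: cos_gt_zero_pi sin_ge_zero)
  have w: "0 \<le> Im w" "norm w \<le> a / cos \<alpha>"
    using z by (auto simp: w_def sector_def angular_cone_def norm_mult simp del: times_complex.sel)
  have "z = w * cis \<alpha>" by (simp add: w_def mult.assoc cis_mult)
  then have "Re z = Re w * cos \<alpha> - Im w * sin \<alpha>" by simp
  also have "\<dots> \<le> norm w * cos \<alpha> - 0"
    using c s w complex_Re_le_cmod[of w] by (intro diff_mono mult_right_mono) auto
  also have "\<dots> \<le> a" using w(2) c by (simp add: field_simps)
  finally show "z \<in> truncated_cone \<alpha> \<beta> a" using z by (simp add: sector_def truncated_cone_def)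
qed

lemma truncated_cone_subset_sector:
  assumes "0 \<le> \<alpha>" "\<alpha> < \<beta>" "\<beta> < pi / 2"
  shows "truncated_cone \<alpha> \<beta> a \<subseteq> sector \<alpha> \<beta> (a / cos \<beta>)"
proof
  fix z assume z: "z \<in> truncated_cone \<alpha> \<beta> a"
  have c: "0 < cos \<beta>" and s: "0 < sin \<beta>" using assms by (auto intro: cos_gt_zero_pi sin_gt_zero)
  have "z \<in> angular_cone 0 \<beta>"
    using angular_cone_0_subset[of \<alpha> \<beta>] assms z by (auto simp: truncated_cone_def)
  then have y: "0 \<le> Im z" "Im z * cos \<beta> \<le> Re z * sin \<beta>"
    by (auto simp: angular_cone_def)
  have "0 \<le> Im z * cos \<beta>" using y(1) c by simp
  then have "0 \<le> Re z * sin \<beta>" using y(2) by linarith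
  then have x: "0 \<le> Re z" using s by (simp add: zero_le_mult_iff)
  have "(norm z * cos \<beta>)\<^sup>2 = (Re z)\<^sup>2 * (cos \<beta>)\<^sup>2 + (Im z * cos \<beta>)\<^sup>2"
    by (simp add: power_mult_distrib cmod_power2 algebra_simps)
  also have "(Im z * cos \<beta>)\<^sup>2 \<le> (Re z * sin \<beta>)\<^sup>2"
    using y c by (intro power_mono) auto
  also have "(Re z)\<^sup>2 * (cos \<beta>)\<^sup>2 + (Re z * sin \<beta>)\<^sup>2 = (Re z)\<^sup>2 * ((sin \<beta>)\<^sup>2 + (cos \<beta>)\<^sup>2)"
    by (simp only: power_mult_distrib distrib_left add.commute)
  finally have "(norm z * cos \<beta>)\<^sup>2 \<le> (Re z)\<^sup>2" by simp
  then have "norm z * cos \<beta> \<le> Re z" using x by (rule power2_le_imp_le)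
  then have "norm z * cos \<beta> \<le> a" using z by (simp add: truncated_cone_def)
  then show "z \<in> sector \<alpha> \<beta> (a / cos \<beta>)"
    using z c by (simp add: sector_def truncated_cone_def field_simps)
qed

lemma bounded_truncated_cone:
  assumes "0 \<le> \<alpha>" "\<alpha> < \<beta>" "\<beta> < pi / 2"
  shows "bounded (truncated_cone \<alpha> \<beta> a)"
  using truncated_cone_subset_sector[OF assms] bounded_sector bounded_subset by blast

context planar_join
begin

lemma join_in_cone:
  assumes "E \<subseteq> angular_cone \<alpha> \<beta>" "x \<in> join E"
  shows "proj x \<in> angular_cone \<alpha> \<beta>"
proof -
  obtain t h z where "0 \<le> t" "h \<in> H" "z \<in> E" "x = (1 - t) *\<^sub>R h + t *\<^sub>R (c + pt z)"
    using assms(2) unfolding join_def by blast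
  then show ?thesis
    using assms(1) by (auto simp: proj_join_point intro: angular_cone_scaleR)
qed

text \<open>A common point lies in the hyperplane over the common ray of the two cones.\<close>

lemma negligible_join_Int:
  assumes "E \<subseteq> angular_cone \<alpha> \<beta>" "F \<subseteq> angular_cone \<beta> \<gamma>"
  shows "negligible (join E \<inter> join F)"
proof (rule negligible_subset)
  let ?n = "cos \<beta> *\<^sub>R v - sin \<beta> *\<^sub>R u"
  have n: "?n \<noteq> 0"
  proof
    assume "?n = 0"
    then have "?n \<bullet> v = 0" "?n \<bullet> u = 0" by simp_all
    then have "cos \<beta> = 0" "sin \<beta> = 0" by (simp_all add: inner_diff_left uv vu)
    then show False using sin_cos_squared_add[of \<beta>] by simp
  qed
  then show "negligible {x. ?n \<bullet> x = 0}" by (intro negligible_hyperplane) simp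
  show "join E \<inter> join F \<subseteq> {x. ?n \<bullet> x = 0}"
  proof
    fix x assume "x \<in> join E \<inter> join F"
    then have "proj x \<in> angular_cone \<alpha> \<beta> \<inter> angular_cone \<beta> \<gamma>"
      using join_in_cone[OF assms(1)] join_in_cone[OF assms(2)] by blast
    then have "Im (proj x * cis (- \<beta>)) = 0" using angular_cone_Int_subset by blast
    then show "x \<in> {x. ?n \<bullet> x = 0}"
      by (simp add: proj_def inner_diff_left inner_commute algebra_simps)
  qed
qed

lemma vol_Un_cones:
  assumes "E \<subseteq> angular_cone \<alpha> \<beta>" "F \<subseteq> angular_cone \<beta> \<gamma>"
    and E: "convex E" "bounded E" and F: "convex F" "bounded F"
  shows "vol (E \<union> F) = vol E + vol F" "ball_vol (E \<union> F) = ball_vol E + ball_vol F"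
proof -
  note m = lmeasurable_join[OF E] lmeasurable_join[OF F]
  have neg: "negligible (join E \<inter> join F)" using assms(1,2) by (rule negligible_join_Int)
  then have "negligible ((join E \<inter> cball 0 1) \<inter> (join F \<inter> cball 0 1))"
    by (rule negligible_subset) auto
  then show "ball_vol (E \<union> F) = ball_vol E + ball_vol F"
    using m by (simp add: ball_vol_def join_Un Int_Un_distrib2 measure_Un3 negligible_imp_measure0)
  show "vol (E \<union> F) = vol E + vol F"
    using m neg by (simp add: vol_def join_Un measure_Un3 negligible_imp_measure0)
qed

lemma vol_cone_split:
  assumes "\<alpha> < \<beta>" "\<beta> < \<gamma>" "\<gamma> < \<alpha> + pi" and X: "convex X" "bounded (angular_cone \<alpha> \<gamma> \<inter> X)"
  shows "vol (angular_cone \<alpha> \<gamma> \<inter> X) = vol (angular_cone \<alpha> \<beta> \<inter> X) + vol (angular_cone \<beta> \<gamma> \<inter> X)"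
    "ball_vol (angular_cone \<alpha> \<gamma> \<inter> X) = ball_vol (angular_cone \<alpha> \<beta> \<inter> X) + ball_vol (angular_cone \<beta> \<gamma> \<inter> X)"
proof -
  have eq: "angular_cone \<alpha> \<gamma> \<inter> X = (angular_cone \<alpha> \<beta> \<inter> X) \<union> (angular_cone \<beta> \<gamma> \<inter> X)"
    using angular_cone_split[OF assms(1-3)] by blast
  then have "bounded (angular_cone \<alpha> \<beta> \<inter> X)" "bounded (angular_cone \<beta> \<gamma> \<inter> X)"
    using X(2) by (metis bounded_Un)+
  then show "vol (angular_cone \<alpha> \<gamma> \<inter> X) = vol (angular_cone \<alpha> \<beta> \<inter> X) + vol (angular_cone \<beta> \<gamma> \<inter> X)"
    "ball_vol (angular_cone \<alpha> \<gamma> \<inter> X) = ball_vol (angular_cone \<alpha> \<beta> \<inter> X) + ball_vol (angular_cone \<beta> \<gamma> \<inter> X)"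
    unfolding eq using vol_Un_cones[of "angular_cone \<alpha> \<beta> \<inter> X" \<alpha> \<beta> "angular_cone \<beta> \<gamma> \<inter> X" \<gamma>]
    by (simp_all add: X(1) convex_angular_cone convex_Int)
qed

lemma sector_linear:
  shows "\<exists>k. \<forall>\<alpha> \<beta>. \<alpha> < \<beta> \<and> \<beta> \<le> \<alpha> + pi / 2 \<longrightarrow> vol (sector \<alpha> \<beta> \<rho>) = k * (\<beta> - \<alpha>)"
    and "\<exists>k. \<forall>\<alpha> \<beta>. \<alpha> < \<beta> \<and> \<beta> \<le> \<alpha> + pi / 2 \<longrightarrow> ball_vol (sector \<alpha> \<beta> \<rho>) = k * (\<beta> - \<alpha>)"
proof -
  have lin: "\<exists>k. \<forall>\<alpha> \<beta>. \<alpha> < \<beta> \<and> \<beta> \<le> \<alpha> + pi / 2 \<longrightarrow> V (sector \<alpha> \<beta> \<rho>) = k * (\<beta> - \<alpha>)"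
    if split: "\<And>\<alpha> \<beta> \<gamma>. \<alpha> < \<beta> \<Longrightarrow> \<beta> < \<gamma> \<Longrightarrow> \<gamma> < \<alpha> + pi \<Longrightarrow>
                 V (sector \<alpha> \<gamma> \<rho>) = V (sector \<alpha> \<beta> \<rho>) + V (sector \<beta> \<gamma> \<rho>)"
      and rot: "\<And>\<alpha> \<beta> \<tau>. V (sector (\<alpha> + \<tau>) (\<beta> + \<tau>) \<rho>) = V (sector \<alpha> \<beta> \<rho>)"
      and nonneg: "\<And>E. 0 \<le> V E" for V :: "complex set \<Rightarrow> real"
  proof -
    define f where "f t = V (sector 0 t \<rho>)" for t
    have Vf: "V (sector \<alpha> \<beta> \<rho>) = f (\<beta> - \<alpha>)" for \<alpha> \<beta>
      using rot[of 0 \<alpha> "\<beta> - \<alpha>"] by (simp add: f_def)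
    have "f t = t * (f (pi / 2) / (pi / 2))" if "0 < t" "t \<le> pi / 2" for t
    proof (rule additive_imp_linear_on[OF _ _ that])
      show "f (s + t) = f s + f t" if "0 < s" "0 < t" "s + t \<le> pi / 2" for s t
        using split[of 0 s "s + t"] that pi_gt_zero unfolding Vf by simp
      show "0 \<le> f s" for s using nonneg by (simp add: f_def)
    qed
    note lin = this
    have "V (sector \<alpha> \<beta> \<rho>) = f (pi / 2) / (pi / 2) * (\<beta> - \<alpha>)" if "\<alpha> < \<beta>" "\<beta> \<le> \<alpha> + pi / 2" for \<alpha> \<beta>
      using lin[of "\<beta> - \<alpha>"] that unfolding Vf by (simp only: mult.commute diff_gt_0_iff_gt diff_le_eq add.commute)
    then show ?thesis by blast
  qed
  have b: "bounded (angular_cone \<alpha> \<gamma> \<inter> cball 0 \<rho>)" for \<alpha> \<gamma>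
    using bounded_sector by (simp add: sector_def)
  show "\<exists>k. \<forall>\<alpha> \<beta>. \<alpha> < \<beta> \<and> \<beta> \<le> \<alpha> + pi / 2 \<longrightarrow> vol (sector \<alpha> \<beta> \<rho>) = k * (\<beta> - \<alpha>)"
  proof (rule lin)
    show "vol (sector (\<alpha> + \<tau>) (\<beta> + \<tau>) \<rho>) = vol (sector \<alpha> \<beta> \<rho>)" for \<alpha> \<beta> \<tau>
      unfolding sector_rotate[symmetric] by (simp add: vol_mult convex_sector bounded_sector factor_1)
  qed (auto simp: sector_def vol_nonneg intro: vol_cone_split[OF _ _ _ convex_cball b])
  show "\<exists>k. \<forall>\<alpha> \<beta>. \<alpha> < \<beta> \<and> \<beta> \<le> \<alpha> + pi / 2 \<longrightarrow> ball_vol (sector \<alpha> \<beta> \<rho>) = k * (\<beta> - \<alpha>)"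
  proof (rule lin)
    show "ball_vol (sector (\<alpha> + \<tau>) (\<beta> + \<tau>) \<rho>) = ball_vol (sector \<alpha> \<beta> \<rho>)" for \<alpha> \<beta> \<tau>
      unfolding sector_rotate[symmetric] by (simp add: ball_vol_rotate convex_sector bounded_sector)
  qed (auto simp: sector_def ball_vol_nonneg intro: vol_cone_split[OF _ _ _ convex_cball b])
qed

section \<open>The density of a sector and of a triangle\<close>

text \<open>The density \<open>q\<close> of the sectors of radius \<open>r\<close> is a lower bound for the density of the truncated cone,
since all its segments have length at most \<open>r\<close>.\<close>

lemma truncated_cone_density_ge:
  assumes q: "0 \<le> q" "\<And>\<alpha> \<beta>. \<alpha> < \<beta> \<Longrightarrow> \<beta> \<le> \<alpha> + pi / 2 \<Longrightarrow>
      ball_vol (sector \<alpha> \<beta> r) = q * vol (sector \<alpha> \<beta> r)"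
    and a: "0 < a" and ab: "0 \<le> \<alpha>" "\<alpha> < \<beta>" "\<beta> < pi / 2" and r: "a / cos \<beta> \<le> r"
  shows "q * vol (truncated_cone \<alpha> \<beta> a) \<le> ball_vol (truncated_cone \<alpha> \<beta> a)"
proof (rule additive_comparison[OF _ _ _ ab(2), of "\<lambda>x y. q * vol (truncated_cone x y a)" "\<lambda>x y. ball_vol (truncated_cone x y a)"
      "CARD('n) / cos \<beta>"])
  have bdd: "bounded (angular_cone x z \<inter> {z. Re z \<le> a})" if "\<alpha> \<le> x" "x < z" "z \<le> \<beta>" for x z
    using bounded_truncated_cone[of x z a] that ab by (simp add: truncated_cone_def)
  show "q * vol (truncated_cone x z a) = q * vol (truncated_cone x y a) + q * vol (truncated_cone y z a)"
    "ball_vol (truncated_cone x z a) = ball_vol (truncated_cone x y a) + ball_vol (truncated_cone y z a)"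
    if "\<alpha> \<le> x" "x < y" "y < z" "z \<le> \<beta>" for x y z
    using vol_cone_split[of x y z "{z. Re z \<le> a}"] that ab bdd[of x z]
    by (simp_all add: truncated_cone_def convex_halfspace_Re_le distrib_left)
  fix x y assume xy: "\<alpha> \<le> x" "x < y" "y \<le> \<beta>"
  have cb: "0 < cos \<beta>" using ab by (intro cos_gt_zero_pi) auto
  have cy: "cos \<beta> \<le> cos y" "0 < cos y" and cx: "cos y < cos x" "0 < cos x"
  proof -
    show "cos \<beta> \<le> cos y" using xy ab by (intro cos_monotone_0_pi_le) auto
    then show "0 < cos y" using cb by simp
    show "cos y < cos x" using xy ab by (intro cos_monotone_0_pi) auto
    then show "0 < cos x" using \<open>0 < cos y\<close> by simp
  qed
  \<comment> \<open>\<open>E\<close> is the circumscribed sector of the piece between \<open>x\<close> and \<open>y\<close>. Shrinking it by \<open>k\<close> gives the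
    inscribed one, and shrinking the sector of radius \<open>r\<close> by \<open>m\<close> gives \<open>E\<close>.\<close>
  define E where "E = sector x y (a / cos y)"
  define k where "k = cos y / cos x"
  define m where "m = a / cos y / r"
  have E: "convex E" "bounded E" by (simp_all add: E_def convex_sector bounded_sector)
  have "a / cos y \<le> a / cos \<beta>" using a cb cy by (intro divide_left_mono) auto
  then have ry: "a / cos y \<le> r" using r by simp
  have r0: "0 < r" using ry a cy by (smt (verit) divide_pos_pos)
  have m: "0 < m" "m \<le> 1" "m * r = a / cos y"
  proof -
    show "m \<le> 1" unfolding m_def using ry r0 by (subst divide_le_eq_1_pos)
  qed (use r0 a cy in \<open>simp_all add: m_def\<close>)
  have k: "0 < k" "k \<le> 1" "k * (a / cos y) = a / cos x" using cx cy by (simp_all add: k_def)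
  have truncated_cone: "convex (truncated_cone x y a)" "bounded (truncated_cone x y a)"
    using xy ab by (auto simp: convex_truncated_cone intro!: bounded_truncated_cone)
  have "q * vol E \<le> ball_vol E"
  proof -
    have Em: "E = (*) (complex_of_real m) ` sector x y r"
      using m by (simp add: E_def sector_scale)
    have "q * vol E = factor m * ball_vol (sector x y r)"
      unfolding Em using xy ab by (simp add: vol_mult convex_sector bounded_sector q(2))
    also have "\<dots> \<le> ball_vol E"
      unfolding Em using m by (intro ball_vol_mult_ge) (auto simp: convex_sector bounded_sector)
    finally show ?thesis .
  qed
  moreover have "vol (truncated_cone x y a) \<le> vol E"
    using truncated_cone E truncated_cone_subset_sector[of x y a] xy ab by (intro vol_mono) (auto simp: E_def)
  ultimately have 1: "q * vol (truncated_cone x y a) \<le> ball_vol E"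
    using q(1) by (meson mult_left_mono order_trans)
  have "1 - CARD('n) / cos \<beta> * (y - x) \<le> k ^ CARD('n)"
  proof -
    have "cos x - cos y \<le> y - x"
    proof -
      have "cos x - cos y = 2 * (sin ((x + y) / 2) * sin ((y - x) / 2))"
        by (simp add: cos_diff_cos)
      also have "sin ((x + y) / 2) * sin ((y - x) / 2) \<le> 1 * ((y - x) / 2)"
        using xy ab by (intro mult_mono sin_x_le_x sin_ge_zero) auto
      finally show ?thesis by simp
    qed
    then have "(cos x - cos y) / cos x \<le> (y - x) / cos \<beta>"
      using cx cy cb xy by (intro frac_le) auto
    then have "CARD('n) * ((cos x - cos y) / cos x) \<le> CARD('n) * ((y - x) / cos \<beta>)"
      by (intro mult_left_mono) auto
    moreover have "1 + CARD('n) * (k - 1) \<le> (1 + (k - 1)) ^ CARD('n)"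
      using k by (intro Bernoulli_inequality) simp
    moreover have "(cos x - cos y) / cos x = 1 - k" using cx by (simp add: k_def diff_divide_distrib)
    ultimately show ?thesis by (simp add: algebra_simps)
  qed
  then have "(1 - CARD('n) / cos \<beta> * (y - x)) * (q * vol (truncated_cone x y a)) \<le> k ^ CARD('n) * (q * vol (truncated_cone x y a))"
    using q(1) vol_nonneg by (intro mult_right_mono) auto
  also have "\<dots> \<le> k ^ CARD('n) * ball_vol E"
    using 1 k by (intro mult_left_mono) auto
  also have "\<dots> \<le> factor k * ball_vol E"
    using factor_bounds(1)[of k] k ball_vol_nonneg by (intro mult_right_mono) auto
  also have "\<dots> \<le> ball_vol ((*) (complex_of_real k) ` E)"
    using E k by (intro ball_vol_mult_ge) auto
  also have "(*) (complex_of_real k) ` E = sector x y (a / cos x)"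
    using k by (simp add: E_def sector_scale)
  also have "ball_vol \<dots> \<le> ball_vol (truncated_cone x y a)"
    using sector_subset_truncated_cone[of x y a] xy ab truncated_cone by (intro vol_mono) (auto simp: convex_sector bounded_sector)
  finally show "(1 - CARD('n) / cos \<beta> * (y - x)) * (q * vol (truncated_cone x y a)) \<le> ball_vol (truncated_cone x y a)" .
qed

text \<open>Because \<open>norm c \<ge> 1\<close>, the join sticks out of the unit ball, so it has an interior point \<open>y\<close> on the unit
sphere, and \<open>y\<close> can be chosen off the orthogonal complement of the plane. Contracting the plane moves
\<open>y\<close>, and also a small ball just outside the unit sphere near \<open>y\<close>, into the unit ball. The image of that
small ball is a gain in volume.\<close>

lemma ball_vol_shrink_gt:
  assumes E: "convex E" "bounded E" "0 < vol E" and z: "z \<in> E" "z \<noteq> 0"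
    and c: "1 \<le> norm c" and t: "0 < t" "t < 1"
  shows "factor (complex_of_real t) * ball_vol E < ball_vol ((*) (complex_of_real t) ` E)"
proof -
  let ?M = "plane_mult (complex_of_real t)"
  let ?J = "join E"
  have J: "convex ?J" "bounded ?J" using E convex_join bounded_join by auto
  have "interior ?J \<noteq> {}"
    using negligible_convex_interior[OF J(1)] negligible_imp_measure0[of ?J] E(3) by (auto simp: vol_def)
  then have cl: "closure (interior ?J) = closure ?J" using J(1) by (rule convex_closure_interior[rotated])
  have cz: "c + pt z \<in> ?J"
    unfolding join_def using H(3) z(1) by (intro CollectI exI[of _ 1] exI[of _ 0] exI[of _ z]) auto
  have J0: "0 \<in> ?J"
    unfolding join_def using H(3) z(1) by (intro CollectI exI[of _ 0] exI[of _ 0] exI[of _ z]) auto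
  have "1 < norm (c + pt z)"
  proof -
    have "(norm (c + pt z))\<^sup>2 = (norm (plane_mult 0 (c + pt z)))\<^sup>2 + (norm z)\<^sup>2"
      using norm_plane_mult[of 0 "c + pt z"] by (simp add: linear_add[OF linear_proj])
    also have "plane_mult 0 (c + pt z) = c"
      by (simp add: plane_mult_def linear_add[OF linear_proj] linear_neg[OF linear_pt])
    finally have "1\<^sup>2 < (norm (c + pt z))\<^sup>2"
      using c z(2) by (smt (verit) one_le_power one_power2 zero_less_norm_iff zero_less_power)
    then show ?thesis by (rule power2_less_imp_less) simp
  qed
  moreover have "proj (c + pt z) \<noteq> 0" using z(2) by (simp add: linear_add[OF linear_proj])
  moreover have "open ({x. 1 < norm x} \<inter> {x. proj x \<noteq> 0})"
    using linear_continuous_on[OF linear_conv_bounded_linear[THEN iffD1, OF linear_proj]]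
    by (intro open_Int open_Collect_less open_Collect_neq continuous_intros) auto
  moreover have "c + pt z \<in> closure (interior ?J)" using cz cl closure_subset by blast
  ultimately obtain y0 where y0: "y0 \<in> interior ?J" "1 < norm y0" "proj y0 \<noteq> 0"
    by (auto simp: closure_iff_nhds_not_empty)
  define y where "y = (1 / norm y0) *\<^sub>R y0"
  have y: "norm y = 1" "proj y \<noteq> 0"
    using y0 by (auto simp: y_def linear_scale[OF linear_proj])
  have "y \<in> interior ?J"
    using mem_interior_closure_convex_shrink[OF J(1) y0(1), of 0 "1 / norm y0"] y0(2) J0 closure_subset
    by (force simp: y_def)
  moreover have "norm (?M y) < 1"
  proof -
    have "((norm (complex_of_real t))\<^sup>2 - 1) * (norm (proj y))\<^sup>2 < 0"
      using t y(2) by (intro mult_neg_pos) (auto simp: power_less_one_iff)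
    then have "(norm (?M y))\<^sup>2 < 1\<^sup>2" using norm_plane_mult[of t y] y(1) by simp
    then show ?thesis by (rule power2_less_imp_less) simp
  qed
  moreover have "open (interior ?J \<inter> {x. norm (?M x) < 1})"
    using linear_continuous_on[OF linear_conv_bounded_linear[THEN iffD1, OF linear_plane_mult[of t]]]
    by (intro open_Int open_interior open_Collect_less continuous_intros) auto
  ultimately have "\<exists>e>0. ball y e \<subseteq> interior ?J \<inter> {x. norm (?M x) < 1}"
    unfolding open_contains_ball by blast
  then obtain e where e: "0 < e" "ball y e \<subseteq> interior ?J \<inter> {x. norm (?M x) < 1}" by blast
  define U where "U = ball y e \<inter> {x. 1 < norm x}"
  have "open U" unfolding U_def by (intro open_Int open_ball open_Collect_less continuous_intros)
  moreover have "(1 + e / 2) *\<^sub>R y \<in> U"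
  proof -
    have "y - (1 + e / 2) *\<^sub>R y = (- (e / 2)) *\<^sub>R y" by (simp add: algebra_simps)
    then have "dist y ((1 + e / 2) *\<^sub>R y) = e / 2"
      using y(1) e(1) by (simp add: dist_norm del: scaleR_minus_left)
    then show ?thesis using y(1) e(1) by (simp add: U_def)
  qed
  ultimately have "\<exists>s>0. ball ((1 + e / 2) *\<^sub>R y) s \<subseteq> U"
    unfolding open_contains_ball by blast
  then obtain s where s: "0 < s" "ball ((1 + e / 2) *\<^sub>R y) s \<subseteq> U" by blast
  define S where "S = ball ((1 + e / 2) *\<^sub>R y) s"
  have S: "S \<in> lmeasurable" "0 < measure lebesgue S" using s(1) by (auto simp: S_def content_ball_pos)
  have S1: "x \<in> ?J" "norm (?M x) \<le> 1" "1 < norm x" if "x \<in> S" for x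
  proof -
    have x: "x \<in> ball y e" "1 < norm x" using that s(2) by (auto simp: S_def U_def)
    then have "x \<in> interior ?J" "norm (?M x) < 1" using e(2) by auto
    then show "x \<in> ?J" "norm (?M x) \<le> 1" "1 < norm x" using interior_subset x(2) by auto
  qed
  let ?A = "?M ` (?J \<inter> cball 0 1)"
  have Am: "?A \<in> lmeasurable" and Sm: "?M ` S \<in> lmeasurable"
    using lmeasurable_join(2)[OF E(1,2)] S(1) by (auto intro: factor(2))
  have m: "convex ((*) (complex_of_real t) ` E)" "bounded ((*) (complex_of_real t) ` E)"
    using E convex_linear_image[OF bounded_linear.linear[OF bounded_linear_mult_right]]
      bounded_linear_image[OF _ bounded_linear_mult_right] by blast+
  have "?A \<inter> ?M ` S = ?M ` ((?J \<inter> cball 0 1) \<inter> S)"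
    using inj_plane_mult[of t] t by (simp add: image_Int)
  also have "(?J \<inter> cball 0 1) \<inter> S = {}" using S1(3) by force
  finally have disj: "?A \<inter> ?M ` S = {}" by simp
  have "factor t * ball_vol E < factor t * ball_vol E + factor t * measure lebesgue S"
    using S(2) t factor_pos[of t] by simp
  also have "\<dots> = measure lebesgue (?A \<union> ?M ` S)"
    using measure_Un3[OF Am Sm] disj factor(3)[OF S(1)] factor(3)[OF lmeasurable_join(2)[OF E(1,2)]]
    by (simp add: ball_vol_def)
  also have "\<dots> \<le> ball_vol ((*) (complex_of_real t) ` E)"
    unfolding ball_vol_def
  proof (rule measure_mono_fmeasurable)
    have "norm (?M x) \<le> 1" if "norm x \<le> 1" for x
      using order_trans[OF norm_plane_mult_le that] t by simp
    then show "?A \<union> ?M ` S \<subseteq> join ((*) (complex_of_real t) ` E) \<inter> cball 0 1"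
      unfolding plane_mult_join[symmetric] using S1 by auto
  qed (use Am Sm lmeasurable_join(2)[OF m] in \<open>auto simp: fmeasurableD\<close>)
  finally show ?thesis .
qed

theorem sector_lowers_density:
  assumes c: "1 \<le> norm c" and a: "0 < a"
    and ang: "0 < \<phi>" "\<phi> < \<psi>" "\<psi> < pi / 2"
    and pos: "0 < vol (truncated_cone 0 \<phi> a)"
  defines "r \<equiv> a / cos \<phi>"
  shows "ball_vol (truncated_cone 0 \<phi> a \<union> sector \<phi> \<psi> r) / vol (truncated_cone 0 \<phi> a \<union> sector \<phi> \<psi> r)
       < ball_vol (truncated_cone 0 \<phi> a) / vol (truncated_cone 0 \<phi> a)"
proof -
  obtain k where k: "\<And>\<alpha> \<beta>. \<alpha> < \<beta> \<Longrightarrow> \<beta> \<le> \<alpha> + pi / 2 \<Longrightarrow> vol (sector \<alpha> \<beta> r) = k * (\<beta> - \<alpha>)"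
    using sector_linear(1)[of r] by blast
  have truncated_cone: "convex (truncated_cone 0 \<phi> a)" "bounded (truncated_cone 0 \<phi> a)"
    using ang by (auto simp: convex_truncated_cone intro!: bounded_truncated_cone)
  have "vol (truncated_cone 0 \<phi> a) \<le> vol (sector 0 \<phi> r)"
    unfolding r_def using truncated_cone_subset_sector[of 0 \<phi> a] ang truncated_cone
    by (intro vol_mono) (auto simp: convex_sector bounded_sector)
  then have "0 < k * \<phi>" using pos k[of 0 \<phi>] ang by simp
  then have k0: "0 < k" using ang by (simp add: zero_less_mult_iff)
  have cos: "0 < cos \<phi>" "cos \<phi> < cos (\<phi> / 2)" "0 < cos (\<phi> / 2)"
  proof -
    show "0 < cos \<phi>" "0 < cos (\<phi> / 2)" using ang by (auto intro!: cos_gt_zero_pi)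
    show "cos \<phi> < cos (\<phi> / 2)" using ang by (intro cos_monotone_0_pi) auto
  qed
  have r: "0 < r" using a cos by (simp add: r_def)
  \<comment> \<open>\<open>r'\<close> is the length of the segment that halves the angle of the triangle. It bounds the
    radii in one half of the triangle and is less than \<open>r\<close>: this is where strictness comes from.\<close>
  define r' where "r' = a / cos (\<phi> / 2)"
  define t where "t = cos \<phi> / cos (\<phi> / 2)"
  have t: "0 < t" "t < 1" "t * r = r'" using cos by (simp_all add: t_def r_def r'_def)
  have density: "\<exists>q\<ge>0. \<forall>\<alpha> \<beta>. \<alpha> < \<beta> \<and> \<beta> \<le> \<alpha> + pi / 2 \<longrightarrow> ball_vol (sector \<alpha> \<beta> \<rho>) = q * vol (sector \<alpha> \<beta> \<rho>)"
    if "0 < vol (sector 0 \<phi> \<rho>)" for \<rho>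
  proof -
    obtain l m where l: "\<And>\<alpha> \<beta>. \<alpha> < \<beta> \<Longrightarrow> \<beta> \<le> \<alpha> + pi / 2 \<Longrightarrow> vol (sector \<alpha> \<beta> \<rho>) = l * (\<beta> - \<alpha>)"
      and m: "\<And>\<alpha> \<beta>. \<alpha> < \<beta> \<Longrightarrow> \<beta> \<le> \<alpha> + pi / 2 \<Longrightarrow> ball_vol (sector \<alpha> \<beta> \<rho>) = m * (\<beta> - \<alpha>)"
      using sector_linear[of \<rho>] by blast
    have "0 < l" using that l[of 0 \<phi>] ang by (simp add: zero_less_mult_iff)
    moreover have "0 \<le> m" using m[of 0 \<phi>] ang ball_vol_nonneg[of "sector 0 \<phi> \<rho>"] by (simp add: zero_le_mult_iff)
    ultimately show ?thesis using l m by (intro exI[of _ "m / l"]) auto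
  qed
  have vol_r: "0 < vol (sector 0 \<beta> r)" if "0 < \<beta>" "\<beta> < pi / 2" for \<beta>
    using k[of 0 \<beta>] that k0 by simp
  have r'_eq: "sector 0 \<beta> r' = (*) (complex_of_real t) ` sector 0 \<beta> r" for \<beta>
    using sector_scale[OF t(1), of 0 \<beta> r] t(3) by simp
  have vol_r': "0 < vol (sector 0 \<phi> r')"
    unfolding r'_eq using t vol_r[of \<phi>] ang factor_pos[of t]
    by (simp add: vol_mult convex_sector bounded_sector)
  obtain q where q: "0 \<le> q" "\<And>\<alpha> \<beta>. \<alpha> < \<beta> \<Longrightarrow> \<beta> \<le> \<alpha> + pi / 2 \<Longrightarrow> ball_vol (sector \<alpha> \<beta> r) = q * vol (sector \<alpha> \<beta> r)"
    using density[OF vol_r[of \<phi>]] ang by auto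
  obtain q' where q': "0 \<le> q'" "\<And>\<alpha> \<beta>. \<alpha> < \<beta> \<Longrightarrow> \<beta> \<le> \<alpha> + pi / 2 \<Longrightarrow> ball_vol (sector \<alpha> \<beta> r') = q' * vol (sector \<alpha> \<beta> r')"
    using density[OF vol_r'] by auto
  have "q < q'"
  proof -
    have "complex_of_real r \<in> sector 0 \<phi> r"
      using r ang by (simp add: sector_def angular_cone_def sin_ge_zero)
    then have "factor t * ball_vol (sector 0 \<phi> r) < ball_vol (sector 0 \<phi> r')"
      unfolding r'_eq using c t r vol_r[of \<phi>] ang
      by (intro ball_vol_shrink_gt[where z = r]) (auto simp: convex_sector bounded_sector)
    also have "\<dots> = q' * (factor t * vol (sector 0 \<phi> r))"
      using q'(2)[of 0 \<phi>] ang by (simp add: r'_eq vol_mult convex_sector bounded_sector)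
    finally have "q * (factor t * vol (sector 0 \<phi> r)) < q' * (factor t * vol (sector 0 \<phi> r))"
      using q(2)[of 0 \<phi>] ang by (simp add: mult.left_commute)
    then show "q < q'"
      using vol_r[of \<phi>] ang factor_pos[of t] t by (simp add: mult_less_cancel_right)
  qed
  let ?T1 = "truncated_cone 0 (\<phi> / 2) a" and ?T2 = "truncated_cone (\<phi> / 2) \<phi> a"
  have split: "vol (truncated_cone 0 \<phi> a) = vol ?T1 + vol ?T2" "ball_vol (truncated_cone 0 \<phi> a) = ball_vol ?T1 + ball_vol ?T2"
    using vol_cone_split[of 0 "\<phi> / 2" \<phi> "{z. Re z \<le> a}"] truncated_cone(2) ang
    by (simp_all add: truncated_cone_def convex_halfspace_Re_le)
  have T1: "0 < vol ?T1"
  proof -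
    have "sector 0 (\<phi> / 2) a \<subseteq> ?T1" using sector_subset_truncated_cone[of 0 "\<phi> / 2" a] by simp
    then have "vol (sector 0 (\<phi> / 2) a) \<le> vol ?T1"
      using ang by (intro vol_mono) (auto simp: convex_sector bounded_sector convex_truncated_cone intro!: bounded_truncated_cone)
    moreover have "sector 0 (\<phi> / 2) a = (*) (complex_of_real (cos \<phi>)) ` sector 0 (\<phi> / 2) r"
      using sector_scale[OF cos(1), of 0 "\<phi> / 2" r] cos(1) by (simp add: r_def)
    moreover have "0 < factor (cos \<phi>)" using cos(1) by (intro factor_pos) auto
    ultimately show ?thesis
      using vol_r[of "\<phi> / 2"] ang by (simp add: vol_mult convex_sector bounded_sector) (smt (verit) mult_pos_pos)
  qed
  have "q' * vol ?T1 \<le> ball_vol ?T1"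
    using q' a ang by (intro truncated_cone_density_ge[of q' r']) (auto simp: r'_def)
  moreover have "q * vol ?T2 \<le> ball_vol ?T2"
    using q a ang by (intro truncated_cone_density_ge[of q r]) (auto simp: r_def)
  moreover have "q * vol ?T1 < q' * vol ?T1" using \<open>q < q'\<close> T1 by simp
  ultimately have T: "q * vol (truncated_cone 0 \<phi> a) < ball_vol (truncated_cone 0 \<phi> a)"
    unfolding split by (simp add: distrib_left)
  let ?C = "sector \<phi> \<psi> r"
  have C: "0 < vol ?C" "ball_vol ?C = q * vol ?C"
    using k[of \<phi> \<psi>] q(2)[of \<phi> \<psi>] k0 ang by simp_all
  have Un: "vol (truncated_cone 0 \<phi> a \<union> ?C) = vol (truncated_cone 0 \<phi> a) + vol ?C"
    "ball_vol (truncated_cone 0 \<phi> a \<union> ?C) = ball_vol (truncated_cone 0 \<phi> a) + q * vol ?C"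
    using vol_Un_cones[of "truncated_cone 0 \<phi> a" 0 \<phi> ?C \<psi>] truncated_cone C(2)
    by (auto simp: truncated_cone_def sector_def convex_sector[unfolded sector_def] bounded_sector[unfolded sector_def])
  have "(q * vol (truncated_cone 0 \<phi> a)) * vol ?C < ball_vol (truncated_cone 0 \<phi> a) * vol ?C"
    using T C(1) by simp
  then show ?thesis
    unfolding Un using pos C(1) by (simp add: divide_less_eq less_divide_eq field_simps)
qed

end

section \<open>The regular simplex is cut into orthoschemes\<close>

text \<open>For a list of the vertices of a regular simplex, the order of the distances to the vertices is the
reverse order of the barycentric coordinates. So the chambers are the simplices of the barycentric
subdivision. Defining them by distances makes them compatible with isometries and puts the
overlap of two of them into the bisectors of two vertices.\<close>

definition chamber :: "(real^'n) list \<Rightarrow> (real^'n) set" where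
  "chamber xs = {x \<in> convex hull (set xs). sorted (map (dist x) xs)}"

lemma bisector_eq:
  fixes p q :: "'a::euclidean_space"
  shows "{x. dist x p \<le> dist x q} = {x. (q - p) \<bullet> x \<le> (q \<bullet> q - p \<bullet> p) / 2}"
    and "{x. dist x p = dist x q} = {x. (q - p) \<bullet> x = (q \<bullet> q - p \<bullet> p) / 2}"
  by (auto simp: dist_norm norm_eq_sqrt_inner inner_diff inner_commute field_simps)

lemma chamber_eq:
  "chamber xs = convex hull (set xs) \<inter>
     (\<Inter>j<length xs. \<Inter>i\<le>j. {x. dist x (xs ! i) \<le> dist x (xs ! j)})"
  by (auto simp: chamber_def sorted_iff_nth_mono)

lemma convex_chamber: "convex (chamber xs)"
  unfolding chamber_eq bisector_eq
  by (intro convex_Int convex_INT convex_halfspace_le convex_convex_hull)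

lemma lmeasurable_chamber: "chamber xs \<in> lmeasurable"
proof (rule measurable_convex[OF convex_chamber])
  have "bounded (convex hull (set xs))"
    by (simp add: bounded_convex_hull finite_imp_bounded)
  then show "bounded (chamber xs)" by (rule bounded_subset) (auto simp: chamber_def)
qed

lemma chamber_Int_balls:
  assumes "xs \<noteq> []"
  shows "chamber xs \<inter> (\<Union>v\<in>set xs. cball v 1) = chamber xs \<inter> cball (xs ! 0) 1"
proof -
  have "dist x (xs ! 0) \<le> dist x v" if "x \<in> chamber xs" "v \<in> set xs" for x v
  proof -
    obtain j where "j < length xs" "v = xs ! j" using \<open>v \<in> set xs\<close> by (auto simp: in_set_conv_nth)
    then show ?thesis using that(1) unfolding chamber_eq by auto
  qed
  then show ?thesis
    using assms by (fastforce simp: dist_commute)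
qed

lemma chambers_cover:
  assumes "finite V"
  shows "convex hull V = (\<Union>xs\<in>permutations_of_set V. chamber xs)"
proof
  show "(\<Union>xs\<in>permutations_of_set V. chamber xs) \<subseteq> convex hull V"
    by (auto simp: chamber_def permutations_of_set_def)
  show "convex hull V \<subseteq> (\<Union>xs\<in>permutations_of_set V. chamber xs)"
  proof
    fix x assume x: "x \<in> convex hull V"
    obtain ys where ys: "set ys = V" "distinct ys" using finite_distinct_list[OF assms] by blast
    let ?xs = "sort_key (dist x) ys"
    have "?xs \<in> permutations_of_set V" using ys by (simp add: permutations_of_set_def)
    moreover have "x \<in> chamber ?xs" using x ys by (simp add: chamber_def)
    ultimately show "x \<in> (\<Union>xs\<in>permutations_of_set V. chamber xs)" by blast
  qed
qed

lemma negligible_chamber_Int: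
  fixes V :: "(real^'n) set"
  assumes "finite V" "xs \<in> permutations_of_set V" "ys \<in> permutations_of_set V" "xs \<noteq> ys"
  shows "negligible (chamber xs \<inter> chamber ys)"
proof (rule negligible_subset)
  let ?N = "\<Union>p\<in>V. \<Union>q\<in>V - {p}. {x. dist x p = dist x q}"
  show "negligible ?N"
  proof -
    have "negligible {x. dist x p = dist x q}" if "p \<noteq> q" for p q :: "real^'n"
      unfolding bisector_eq using that by (intro negligible_hyperplane) simp
    then show ?thesis
      using assms(1) by (auto intro!: negligible_Union) metis
  qed
  have set: "set xs = V" "distinct xs" "set ys = V" "distinct ys"
    using assms by (auto simp: permutations_of_set_def)
  show "chamber xs \<inter> chamber ys \<subseteq> ?N"
  proof
    fix x assume x: "x \<in> chamber xs \<inter> chamber ys"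
    show "x \<in> ?N"
    proof (rule ccontr)
      assume "x \<notin> ?N"
      then have inj: "inj_on (dist x) V" unfolding inj_on_def by blast
      have "map (dist x) xs = map (dist x) ys"
        using x set inj by (intro sorted_distinct_set_unique) (auto simp: chamber_def distinct_map)
      then have "xs = ys" using set inj by (auto dest: map_inj_on)
      then show False using assms(4) by simp
    qed
  qed
qed

lemma chamber_isometry:
  assumes f: "orthogonal_transformation f"
  shows "(\<lambda>x. a + f x) ` chamber xs = chamber (map (\<lambda>x. a + f x) xs)"
proof -
  let ?g = "\<lambda>x. a + f x"
  have lin: "linear f" using f by (rule orthogonal_transformation_linear)
  have dist: "dist (f x) (f y) = dist x y" for x y
    using orthogonal_transformation_norm[OF f, of "x - y"] by (simp add: dist_norm linear_diff[OF lin])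
  have "?g ` S = (+) a ` f ` S" for S by (simp add: image_image)
  then have hull: "?g ` (convex hull (set xs)) = convex hull (?g ` set xs)"
    by (simp only: convex_hull_linear_image[OF lin] convex_hull_translation)
  have "sorted (map (dist (?g x)) (map ?g xs)) = sorted (map (dist x) xs)" for x
    by (simp add: dist o_def)
  then show ?thesis
    unfolding chamber_def set_map hull[symmetric] by auto
qed

text \<open>The distances determine all inner products of the vectors \<open>x i - x 0\<close> and \<open>y i - y 0\<close>, so the linear map
that takes the first basis to the second one preserves inner products.\<close>

lemma equidistant_isometry:
  fixes x y :: "nat \<Rightarrow> real^'n"
  assumes x: "\<And>i j. i \<le> CARD('n) \<Longrightarrow> j \<le> CARD('n) \<Longrightarrow> i \<noteq> j \<Longrightarrow> dist (x i) (x j) = l"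
    and y: "\<And>i j. i \<le> CARD('n) \<Longrightarrow> j \<le> CARD('n) \<Longrightarrow> i \<noteq> j \<Longrightarrow> dist (y i) (y j) = l"
    and l: "l \<noteq> 0" and x0: "x 0 = 0"
  shows "\<exists>f. orthogonal_transformation f \<and> (\<forall>i\<le>CARD('n). y i = y 0 + f (x i))"
proof -
  let ?d = "CARD('n)"
  have inj: "inj_on x {0..?d}" using x l by (auto simp: inj_on_def) (metis dist_self)
  let ?B = "x ` {1..?d}"
  have "{0..?d} = insert 0 {1..?d}" by auto
  then have im: "x ` {0..?d} = insert 0 ?B" using x0 by (metis image_insert)
  have notin: "0 \<notin> ?B"
  proof
    assume "0 \<in> ?B"
    then obtain i where "i \<in> {1..?d}" "x i = x 0" using x0 by auto
    then show False using x[of i 0] l by simp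
  qed
  have "\<not> affine_dependent (x ` {0..?d})"
    by (rule equidistant_affine_independent[OF _ l]) (auto simp: pairwise_def intro!: x)
  then have ind: "independent ?B"
    unfolding im using affine_dependent_iff_dependent[OF notin] by simp
  have "card ?B = ?d"
    using card_image[OF inj_on_subset[OF inj], of "{1..?d}"] by simp
  then have span: "span ?B = UNIV"
    using card_eq_dim[of ?B UNIV] ind by auto
  define h where "h = (\<lambda>z. y (THE i. i \<in> {1..?d} \<and> x i = z) - y 0)"
  obtain f where f: "linear f" "\<forall>z\<in>?B. f z = h z"
    using linear_independent_extend[OF ind] by blast
  have fx: "f (x i) = y i - y 0" if i: "i \<in> {1..?d}" for i
  proof -
    have "(THE j. j \<in> {1..?d} \<and> x j = x i) = i"
      using i inj by (intro the_equality) (auto simp: inj_on_def)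
    then show ?thesis using f(2) i by (simp add: h_def)
  qed
  have eq: "f z \<bullet> f z' = z \<bullet> z'" for z z'
  proof (rule bilinear_eq[of "\<lambda>z z'. f z \<bullet> f z'" "\<lambda>z z'. z \<bullet> z'" UNIV ?B UNIV ?B])
    show "bilinear (\<lambda>z z'. f z \<bullet> f z')"
      unfolding bilinear_def
      by (intro allI conjI linearI) (simp_all add: linear_add[OF f(1)] linear_scale[OF f(1)] inner_add)
    show "bilinear (\<lambda>z z'. z \<bullet> z' :: real)"
      unfolding bilinear_def by (intro allI conjI linearI) (simp_all add: inner_add)
    fix a b assume "a \<in> ?B" "b \<in> ?B"
    then obtain i j where ij: "i \<in> {1..?d}" "j \<in> {1..?d}" "a = x i" "b = x j" by auto
    have n: "norm (x k) = l" "norm (y k - y 0) = l" if "k \<in> {1..?d}" for k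
      using that x[of k 0] y[of k 0] x0 by (auto simp: dist_norm)
    have "norm (x i - x j) = norm (y i - y j)"
      using x[of i j] y[of i j] ij by (cases "i = j") (auto simp: dist_norm)
    then show "f a \<bullet> f b = a \<bullet> b"
      using n ij unfolding ij(3,4) by (simp add: fx dot_norm_neg)
  qed (use span in auto)
  show ?thesis
  proof (intro exI[of _ f] conjI allI impI)
    show "orthogonal_transformation f"
      unfolding orthogonal_transformation_def using f(1) eq by simp
    show "y i = y 0 + f (x i)" if "i \<le> ?d" for i
    proof (cases "i = 0")
      case True
      then show ?thesis by (simp add: x0 linear_0[OF f(1)])
    next
      case False
      then show ?thesis using fx[of i] that by simp
    qed
  qed
qed

text \<open>Summation by parts. For \<open>y j\<close> the barycentre of the first \<open>j + 1\<close> vertices of a simplex, the difference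
on the left-hand side is the vertex with index \<open>j\<close>. So this turns barycentric coordinates \<open>a\<close> with respect to
the vertices into coordinates with respect to the barycentres, which are nonnegative if \<open>a\<close> decreases.\<close>

lemma sum_by_parts_barycentric:
  fixes y :: "nat \<Rightarrow> 'a::real_vector"
  shows "(\<Sum>j\<le>n. a j *\<^sub>R ((real j + 1) *\<^sub>R y j - real j *\<^sub>R y (j - 1))) =
    (\<Sum>j\<le>n. ((real j + 1) * (a j - a (j + 1))) *\<^sub>R y j) + ((real n + 1) * a (n + 1)) *\<^sub>R y n"
proof (induction n)
  case 0
  show ?case by (simp add: algebra_simps)
next
  case (Suc n)
  show ?case
    unfolding sum.atMost_Suc Suc by (simp add: algebra_simps)
qed

text \<open>The orthoscheme vertices, started with \<open>w 0 = 0\<close>, by their inner products.\<close>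

locale orthoscheme =
  fixes w :: "nat \<Rightarrow> real^'n"
  assumes w0: "w 0 = 0"
    and gram: "\<And>i j. i \<le> j \<Longrightarrow> j \<le> CARD('n) \<Longrightarrow> w i \<bullet> w j = 2 * real i / (real i + 1)"
begin

text \<open>The vertices of the regular simplex for which \<open>w i\<close> is the barycentre of \<open>vertex 0, \<dots>, vertex i\<close>.\<close>

definition vertex :: "nat \<Rightarrow> real^'n" where
  "vertex i = (real i + 1) *\<^sub>R w i - real i *\<^sub>R w (i - 1)"

lemma vertex_0: "vertex 0 = 0"
  by (simp add: vertex_def w0)

lemma w_inner_vertex:
  assumes "i \<le> CARD('n)" "j \<le> CARD('n)" "1 \<le> j"
  shows "w i \<bullet> vertex j = (if j \<le> i then 2 else 2 * real i / (real i + 1))"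
proof -
  obtain k where k: "j = Suc k" using assms by (cases j) auto
  show ?thesis
  proof (cases "j \<le> i")
    case True
    then have "(real j + 1) * (w i \<bullet> w j) = 2 * real j" "(real k + 1) * (w i \<bullet> w k) = 2 * real k"
      using gram[of j i] gram[of k i] assms k
      by (simp_all only: inner_commute[of "w i"]) (simp_all add: field_simps)
    moreover have "w i \<bullet> vertex j = (real j + 1) * (w i \<bullet> w j) - (real k + 1) * (w i \<bullet> w k)"
      by (simp add: vertex_def inner_diff_right k add.commute)
    ultimately show ?thesis using True k by simp
  next
    case False
    then have "w i \<bullet> w j = 2 * real i / (real i + 1)" "w i \<bullet> w k = 2 * real i / (real i + 1)"
      using gram[of i j] gram[of i k] assms k by simp_all
    then have "w i \<bullet> vertex j = ((real j + 1) - real j) * (2 * real i / (real i + 1))"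
      by (simp only: vertex_def inner_diff_right k inner_scaleR_right left_diff_distrib diff_Suc_1)
    then show ?thesis using False by simp
  qed
qed

lemma vertex_inner_vertex:
  assumes "i \<le> CARD('n)" "j \<le> CARD('n)" "1 \<le> i" "1 \<le> j"
  shows "vertex i \<bullet> vertex j = (if i = j then 4 else 2)"
proof -
  have less: "vertex i \<bullet> vertex j = 2" if "i \<le> CARD('n)" "1 \<le> j" "j < i" for i j
    using that w_inner_vertex[of i j] w_inner_vertex[of "i - 1" j]
    by (simp add: vertex_def[of i] inner_diff_left)
  have "vertex i \<bullet> vertex i = (real i + 1) * 2 - real i * (2 * real (i - 1) / (real (i - 1) + 1))"
    using assms w_inner_vertex[of i i] w_inner_vertex[of "i - 1" i]
    by (simp add: vertex_def[of i] inner_diff_left)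
  also have "\<dots> = 4" using assms(3) by (simp add: of_nat_diff)
  finally show ?thesis
    using less[of i j] less[of j i] assms by (cases i j rule: linorder_cases) (auto simp: inner_commute)
qed

lemma dist_vertex:
  assumes "i \<le> CARD('n)" "j \<le> CARD('n)" "i \<noteq> j"
  shows "dist (vertex i) (vertex j) = 2"
proof -
  have "(vertex i - vertex j) \<bullet> (vertex i - vertex j) = 4"
    using assms vertex_inner_vertex[of i i] vertex_inner_vertex[of j j]
      vertex_inner_vertex[of i j] vertex_inner_vertex[of j i]
    by (cases "i = 0"; cases "j = 0") (simp_all add: inner_diff vertex_0)
  then show ?thesis by (simp add: dist_norm norm_eq_sqrt_inner)
qed

text \<open>The vertex \<open>0\<close> is special since the others all have norm \<open>2\<close>.\<close>

lemma dist_vertex_le_iff: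
  assumes "i \<le> CARD('n)" "j \<le> CARD('n)" "1 \<le> j"
  shows "dist x (vertex i) \<le> dist x (vertex j) \<longleftrightarrow>
         x \<bullet> vertex j \<le> (if i = 0 then 2 else x \<bullet> vertex i)"
proof -
  have "dist x (vertex i) \<le> dist x (vertex j) \<longleftrightarrow>
      (vertex j - vertex i) \<bullet> x \<le> (vertex j \<bullet> vertex j - vertex i \<bullet> vertex i) / 2"
    using bisector_eq(1)[of "vertex i" "vertex j"] by blast
  then show ?thesis
    using assms vertex_inner_vertex[of j j] vertex_inner_vertex[of i i]
    by (auto simp: vertex_0 inner_diff_left inner_diff_right inner_commute)
qed

lemma inj_on_vertex: "inj_on vertex {..CARD('n)}"
  using dist_vertex by (auto simp: inj_on_def) (metis dist_self zero_neq_numeral)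

lemma w_in_hull: "i \<le> CARD('n) \<Longrightarrow> w i \<in> convex hull (vertex ` {..CARD('n)})"
proof (induction i)
  case 0
  have "vertex 0 \<in> convex hull (vertex ` {..CARD('n)})" by (intro hull_inc) simp
  then show ?case by (simp add: w0 vertex_0)
next
  case (Suc i)
  let ?a = "real (Suc i) / (real (Suc i) + 1)" and ?b = "1 / (real (Suc i) + 1)"
  have "?a *\<^sub>R w i + ?b *\<^sub>R vertex (Suc i) \<in> convex hull (vertex ` {..CARD('n)})"
  proof (rule convexD[OF convex_convex_hull])
    show "w i \<in> convex hull (vertex ` {..CARD('n)})" using Suc by simp
    show "vertex (Suc i) \<in> convex hull (vertex ` {..CARD('n)})" using Suc by (intro hull_inc) simp
  qed (auto simp: add_divide_distrib[symmetric])
  also have "?b *\<^sub>R vertex (Suc i) = w (Suc i) - ?a *\<^sub>R w i"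
    by (simp add: vertex_def scaleR_diff_right)
  finally show ?case by simp
qed

lemma orthoscheme_eq_chamber:
  "convex hull (w ` {..CARD('n)}) = chamber (map vertex [0..<CARD('n) + 1])"
proof
  let ?d = "CARD('n)"
  have set: "set (map vertex [0..<?d + 1]) = vertex ` {..?d}"
    by (simp only: set_map set_upt atLeast0LessThan Suc_eq_plus1[symmetric] lessThan_Suc_atMost)
  have ch: "x \<in> chamber (map vertex [0..<?d + 1]) \<longleftrightarrow> x \<in> convex hull (vertex ` {..?d}) \<and>
      (\<forall>j\<le>?d. \<forall>i\<le>j. dist x (vertex i) \<le> dist x (vertex j))" for x
    unfolding chamber_eq set by (auto simp del: upt_Suc simp: less_Suc_eq_le)
  show "convex hull (w ` {..?d}) \<subseteq> chamber (map vertex [0..<?d + 1])"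
  proof (rule hull_minimal, rule image_subsetI)
    show "convex (chamber (map vertex [0..<?d + 1]))" by (rule convex_chamber)
    fix k assume k: "k \<in> {..?d}"
    have "dist (w k) (vertex i) \<le> dist (w k) (vertex j)" if "j \<le> ?d" "i \<le> j" for i j
    proof (cases "j = 0")
      case False
      have "2 * real k / (real k + 1) \<le> 2" by (simp add: field_simps)
      then show ?thesis
        using that False k by (auto simp: dist_vertex_le_iff w_inner_vertex)
    qed (use that in auto)
    then show "w k \<in> chamber (map vertex [0..<?d + 1])"
      unfolding ch using w_in_hull k by auto
  qed
  show "chamber (map vertex [0..<?d + 1]) \<subseteq> convex hull (w ` {..?d})"
  proof
    fix x assume x: "x \<in> chamber (map vertex [0..<?d + 1])"
    then have "x \<in> convex hull (vertex ` {..?d})" unfolding ch by blast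
    then obtain u where u: "\<And>z. z \<in> vertex ` {..?d} \<Longrightarrow> 0 \<le> u z" "sum u (vertex ` {..?d}) = 1"
      "(\<Sum>z\<in>vertex ` {..?d}. u z *\<^sub>R z) = x"
      by (auto simp: convex_hull_finite)
    define l where "l j = (if j \<le> ?d then u (vertex j) else 0)" for j
    have l0: "0 \<le> l j" for j using u(1) by (simp add: l_def)
    have l1: "(\<Sum>j\<le>?d. l j) = 1"
      using u(2) by (simp add: sum.reindex[OF inj_on_vertex] l_def)
    have lx: "(\<Sum>j\<le>?d. l j *\<^sub>R vertex j) = x"
      using u(3) by (simp add: sum.reindex[OF inj_on_vertex] l_def)
    have xv: "x \<bullet> vertex j = 2 * (1 - l 0) + 2 * l j" if j: "1 \<le> j" "j \<le> ?d" for j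
    proof -
      have "x \<bullet> vertex j = (\<Sum>k\<le>?d. l k * (vertex k \<bullet> vertex j))"
        unfolding lx[symmetric] by (simp add: inner_sum_left)
      also have "\<dots> = (\<Sum>k\<le>?d. 2 * l k - (if k = 0 then 2 * l 0 else 0) + (if k = j then 2 * l j else 0))"
        using j by (intro sum.cong) (auto simp: vertex_inner_vertex vertex_0)
      also have "\<dots> = 2 * (\<Sum>k\<le>?d. l k) - 2 * l 0 + 2 * l j"
        using j by (simp add: sum.distrib sum_subtractf sum_distrib_left)
      finally show ?thesis using l1 by simp
    qed
    have mono: "l (j + 1) \<le> l j" if j: "j \<le> ?d" for j
    proof (cases "j = ?d")
      case True
      then show ?thesis using l0[of j] l_def[of "j + 1"] by simp
    next
      case False
      then have "dist x (vertex j) \<le> dist x (vertex (j + 1))"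
        using x j unfolding ch by auto
      then show ?thesis
        using dist_vertex_le_iff[of j "j + 1" x] xv[of j] xv[of "j + 1"] j False by (cases "j = 0") auto
    qed
    \<comment> \<open>the barycentric coordinates of \<open>x\<close> with respect to \<open>w 0, \<dots>, w d\<close>\<close>
    define m where "m j = (real j + 1) * (l j - l (j + 1))" for j
    have ld: "l (?d + 1) = 0" by (simp add: l_def)
    have "(\<Sum>j\<le>?d. m j *\<^sub>R w j) = x"
      using sum_by_parts_barycentric[of l w ?d] ld lx by (simp add: m_def vertex_def)
    moreover have "(\<Sum>j\<le>?d. m j) = 1"
    proof -
      have "(\<Sum>j\<le>?d. l j *\<^sub>R ((real j + 1) *\<^sub>R 1 - real j *\<^sub>R (1::real))) = (\<Sum>j\<le>?d. l j)"
        by (intro sum.cong) auto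
      then show ?thesis
        using sum_by_parts_barycentric[of l "\<lambda>_. 1::real" ?d] ld l1 by (simp add: m_def)
    qed
    moreover have "0 \<le> m j" if "j \<le> ?d" for j
      using mono[OF that] by (simp add: m_def)
    moreover have "w j \<in> convex hull (w ` {..?d})" if "j \<le> ?d" for j
      using that by (intro hull_inc) simp
    ultimately show "x \<in> convex hull (w ` {..?d})"
      using convex_sum[of "{..?d}" "convex hull (w ` {..?d})" m w] by auto
  qed
qed

text \<open>All chambers of the regular simplex are congruent to the orthoscheme, by isometries that take the
nearest vertex to \<open>0\<close>.\<close>

theorem rogers_sigma_eq_orthoscheme:
  fixes V :: "(real^'n) set"
  assumes V: "regular_simplex_vertices 2 V"
  shows "rogers_sigma V = measure lebesgue (convex hull (w ` {..CARD('n)}) \<inter> cball 0 1) /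
           measure lebesgue (convex hull (w ` {..CARD('n)}))"
proof -
  let ?d = "CARD('n)" and ?O = "convex hull (w ` {..CARD('n)})" and ?P = "permutations_of_set V"
  have V: "card V = ?d + 1" "\<And>x y. x \<in> V \<Longrightarrow> y \<in> V \<Longrightarrow> x \<noteq> y \<Longrightarrow> dist x y = 2"
    using assms by (auto simp: regular_simplex_vertices_def pairwise_def)
  then have fin: "finite V" by (metis card.infinite add_is_0 one_neq_zero)
  let ?U = "\<Union>v\<in>V. cball v (1::real)"
  have Om: "?O \<in> lmeasurable" "?O \<inter> cball 0 1 \<in> lmeasurable"
    unfolding orthoscheme_eq_chamber
    by (rule lmeasurable_chamber, rule fmeasurable_Int_fmeasurable[OF lmeasurable_chamber]) simp
  have ch: "measure lebesgue (chamber xs) = measure lebesgue ?O"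
    "measure lebesgue (chamber xs \<inter> ?U) = measure lebesgue (?O \<inter> cball 0 1)" if xs: "xs \<in> ?P" for xs
  proof -
    have xs': "set xs = V" "distinct xs" "length xs = ?d + 1"
      using xs V(1) by (auto simp: permutations_of_set_def dest: distinct_card)
    have "dist (xs ! i) (xs ! j) = 2" if "i \<le> ?d" "j \<le> ?d" "i \<noteq> j" for i j
      using V(2)[of "xs ! i" "xs ! j"] that xs' by (auto simp: nth_eq_iff_index_eq)
    then have "\<exists>f. orthogonal_transformation f \<and> (\<forall>i\<le>?d. xs ! i = xs ! 0 + f (vertex i))"
      by (intro equidistant_isometry[where l = 2] dist_vertex vertex_0) auto
    then obtain f where f: "orthogonal_transformation f" "\<And>i. i \<le> ?d \<Longrightarrow> xs ! i = xs ! 0 + f (vertex i)"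
      by blast
    have "xs = map (\<lambda>x. xs ! 0 + f x) (map vertex [0..<?d + 1])"
    proof (rule nth_equalityI)
      fix i assume "i < length xs"
      then have i: "i < ?d + 1" "i \<le> ?d" using xs'(3) by auto
      have "map (\<lambda>x. xs ! 0 + f x) (map vertex [0..<?d + 1]) ! i = xs ! 0 + f (vertex i)"
        using i by (simp del: upt_Suc Suc_eq_plus1_left add: nth_map_upt)
      then show "xs ! i = map (\<lambda>x. xs ! 0 + f x) (map vertex [0..<?d + 1]) ! i"
        using f(2)[OF i(2)] by (simp only:)
    qed (simp add: xs'(3))
    then have c: "chamber xs = (\<lambda>x. xs ! 0 + f x) ` ?O"
      unfolding orthoscheme_eq_chamber chamber_isometry[OF f(1)] by simp
    have "cball (xs ! 0) 1 = (\<lambda>x. xs ! 0 + f x) ` cball 0 1"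
    proof -
      have "f ` cball 0 1 = cball 0 1"
        using image_orthogonal_transformation_cball[OF f(1), of 0 1] orthogonal_transformation_linear[OF f(1)]
        by (simp add: linear_0)
      then have "(\<lambda>x. xs ! 0 + f x) ` cball 0 1 = (+) (xs ! 0) ` cball 0 1"
        by (metis image_image)
      then show ?thesis using cball_translation[of "xs ! 0" 0 1] by simp
    qed
    moreover have "chamber xs \<inter> ?U = chamber xs \<inter> cball (xs ! 0) 1"
      using chamber_Int_balls[of xs] xs' by (metis list.size(3) add_is_0 one_neq_zero)
    moreover have "inj (\<lambda>x. xs ! 0 + f x)"
      using orthogonal_transformation_inj[OF f(1)] by (auto simp: inj_def)
    ultimately have cU: "chamber xs \<inter> ?U = (\<lambda>x. xs ! 0 + f x) ` (?O \<inter> cball 0 1)"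
      by (simp only: c image_Int)
    have m: "measure lebesgue ((\<lambda>x. xs ! 0 + f x) ` S) = measure lebesgue S" if "S \<in> lmeasurable" for S
      using measure_orthogonal_transformation_image[OF f(1) that] measure_translation[of "xs ! 0" "f ` S"]
      by (simp add: image_image)
    show "measure lebesgue (chamber xs) = measure lebesgue ?O" by (simp only: c m[OF Om(1)])
    show "measure lebesgue (chamber xs \<inter> ?U) = measure lebesgue (?O \<inter> cball 0 1)"
      by (simp only: cU m[OF Om(2)])
  qed
  have neg: "pairwise (\<lambda>xs ys. negligible (chamber xs \<inter> chamber ys)) ?P"
    using negligible_chamber_Int[OF fin] by (auto simp: pairwise_def)
  have U: "?U \<in> sets lebesgue"
    using fin by (intro sets.finite_UN) auto
  have "measure lebesgue (convex hull V) = (\<Sum>xs\<in>?P. measure lebesgue (chamber xs))"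
    unfolding chambers_cover[OF fin]
    by (rule measure_negligible_finite_Union_image[OF _ _ neg]) (auto simp: lmeasurable_chamber)
  then have 1: "measure lebesgue (convex hull V) = real (card ?P) * measure lebesgue ?O"
    by (simp add: ch(1))
  have "convex hull V \<inter> ?U = (\<Union>xs\<in>?P. chamber xs \<inter> ?U)"
    unfolding chambers_cover[OF fin] by blast
  moreover have "measure lebesgue (\<Union>xs\<in>?P. chamber xs \<inter> ?U) = (\<Sum>xs\<in>?P. measure lebesgue (chamber xs \<inter> ?U))"
  proof (rule measure_negligible_finite_Union_image)
    show "pairwise (\<lambda>xs ys. negligible ((chamber xs \<inter> ?U) \<inter> (chamber ys \<inter> ?U))) ?P"
      using neg unfolding pairwise_def by (meson negligible_subset Int_mono Int_lower1)
    show "chamber xs \<inter> ?U \<in> lmeasurable" for xs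
      using lmeasurable_chamber U by (rule fmeasurable_Int_fmeasurable)
  qed simp
  ultimately have 2: "measure lebesgue (convex hull V \<inter> ?U) = real (card ?P) * measure lebesgue (?O \<inter> cball 0 1)"
    by (simp add: ch(2))
  have "card ?P \<noteq> 0" using fin by simp
  then show ?thesis unfolding rogers_sigma_def 1 2 by simp
qed

end

section \<open>Coordinates for the body over the extended corner\<close>

lemma image_Collect2: "{h (f s t) | s t. P s t} = h ` {f s t | s t. P s t}"
  by auto

lemma angular_cone_eq_span:
  assumes "\<alpha> < \<beta>" "\<beta> < \<alpha> + pi" "0 < r"
  shows "angular_cone \<alpha> \<beta> = {s *\<^sub>R (r *\<^sub>R cis \<alpha>) + t *\<^sub>R (r *\<^sub>R cis \<beta>) | s t. 0 \<le> s \<and> 0 \<le> t}"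
    (is "_ = ?R")
proof -
  have sin: "0 < sin (\<beta> - \<alpha>)" using assms by (intro sin_gt_zero) auto
  have "z \<in> ?R" if z: "z \<in> angular_cone \<alpha> \<beta>" for z
  proof -
    define s where "s = - Im (z * cis (- \<beta>)) / (r * sin (\<beta> - \<alpha>))"
    define t where "t = Im (z * cis (- \<alpha>)) / (r * sin (\<beta> - \<alpha>))"
    have st: "0 \<le> s" "0 \<le> t"
      using z sin assms(3) unfolding angular_cone_def s_def t_def mem_Collect_eq
      by (auto intro!: divide_nonneg_pos divide_nonpos_pos simp del: times_complex.sel)
    have "sin (\<beta> - \<alpha>) * s * r = - Im (z * cis (- \<beta>))" "sin (\<beta> - \<alpha>) * t * r = Im (z * cis (- \<alpha>))"
      using sin assms(3) by (simp_all add: s_def t_def del: times_complex.sel)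
    moreover have "sin (\<beta> - \<alpha>) *\<^sub>R z = (- Im (z * cis (- \<beta>))) *\<^sub>R cis \<alpha> + Im (z * cis (- \<alpha>)) *\<^sub>R cis \<beta>"
      by (simp add: complex_eq_iff sin_diff algebra_simps)
    ultimately have "sin (\<beta> - \<alpha>) *\<^sub>R z = (sin (\<beta> - \<alpha>) * s * r) *\<^sub>R cis \<alpha> + (sin (\<beta> - \<alpha>) * t * r) *\<^sub>R cis \<beta>"
      by (simp only:)
    then have "sin (\<beta> - \<alpha>) *\<^sub>R z = sin (\<beta> - \<alpha>) *\<^sub>R (s *\<^sub>R (r *\<^sub>R cis \<alpha>) + t *\<^sub>R (r *\<^sub>R cis \<beta>))"
      by (simp add: scaleR_add_right mult.assoc)
    then have "z = s *\<^sub>R (r *\<^sub>R cis \<alpha>) + t *\<^sub>R (r *\<^sub>R cis \<beta>)"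
      using sin by (metis scaleR_cancel_left less_irrefl)
    then show ?thesis using st by blast
  qed
  moreover have "s *\<^sub>R (r *\<^sub>R cis \<alpha>) + t *\<^sub>R (r *\<^sub>R cis \<beta>) \<in> angular_cone \<alpha> \<beta>" if "0 \<le> s" "0 \<le> t" for s t
  proof -
    have "Im ((s *\<^sub>R (r *\<^sub>R cis \<alpha>) + t *\<^sub>R (r *\<^sub>R cis \<beta>)) * cis (- \<alpha>)) = t * r * sin (\<beta> - \<alpha>)"
      "Im ((s *\<^sub>R (r *\<^sub>R cis \<alpha>) + t *\<^sub>R (r *\<^sub>R cis \<beta>)) * cis (- \<beta>)) = - (s * r * sin (\<beta> - \<alpha>))"
      by (simp_all add: sin_diff algebra_simps)
    then show ?thesis using that sin assms(3) by (simp add: angular_cone_def del: times_complex.sel)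
  qed
  ultimately show ?thesis by blast
qed

lemma truncated_cone_eq_triangle:
  assumes "0 < A" "0 < B" "0 < r" "cos \<phi> = A / r" "sin \<phi> = B / r"
  shows "truncated_cone 0 \<phi> A = {(s + t) *\<^sub>R complex_of_real A + t *\<^sub>R Complex 0 B | s t. 0 \<le> s \<and> 0 \<le> t \<and> s + t \<le> 1}"
proof -
  have truncated_cone: "z \<in> truncated_cone 0 \<phi> A \<longleftrightarrow> 0 \<le> Im z \<and> A * Im z \<le> B * Re z \<and> Re z \<le> A" for z
    using assms(3) by (auto simp: truncated_cone_def angular_cone_def assms(4,5) field_simps)
  have "z \<in> {(s + t) *\<^sub>R complex_of_real A + t *\<^sub>R Complex 0 B | s t. 0 \<le> s \<and> 0 \<le> t \<and> s + t \<le> 1}"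
    if "z \<in> truncated_cone 0 \<phi> A" for z
  proof -
    have z: "0 \<le> Im z" "A * Im z \<le> B * Re z" "Re z \<le> A" using that truncated_cone by auto
    have "0 \<le> Re z / A - Im z / B" "0 \<le> Im z / B" "(Re z / A - Im z / B) + Im z / B \<le> 1"
      using z assms(1,2) by (auto simp: field_simps)
    moreover have "z = ((Re z / A - Im z / B) + Im z / B) *\<^sub>R complex_of_real A + (Im z / B) *\<^sub>R Complex 0 B"
      using assms(1,2) by (simp add: complex_eq_iff)
    ultimately show ?thesis by blast
  qed
  moreover have "(s + t) *\<^sub>R complex_of_real A + t *\<^sub>R Complex 0 B \<in> truncated_cone 0 \<phi> A"
    if "0 \<le> s" "0 \<le> t" "s + t \<le> 1" for s t
  proof -
    have "(s + t) * A \<le> 1 * A" using that assms by (intro mult_right_mono) auto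
    moreover have "t * (A * B) \<le> (s + t) * (A * B)" using that assms by (intro mult_right_mono) auto
    ultimately show ?thesis using that assms unfolding truncated_cone by (simp add: algebra_simps)
  qed
  ultimately show ?thesis by blast
qed

lemma orthoscheme_gram:
  fixes w :: "nat \<Rightarrow> real^'n"
  assumes w: "orthoscheme_vertices w" and ij: "1 \<le> i" "i \<le> j" "j \<le> CARD('n)"
  shows "w i \<bullet> w j = 2 * real i / (real i + 1)"
proof -
  have nrm: "w i \<bullet> w i = 2 * real i / (real i + 1)"
  proof -
    have "norm (w i) = sqrt (2 * real i / (real i + 1))"
      using w ij unfolding orthoscheme_vertices_def Let_def by auto
    then show ?thesis by (simp add: power2_norm_eq_inner[symmetric])
  qed
  show ?thesis
  proof (cases "i = j")
    case False
    then have "w j - w i \<in> span {w j - w i | j. i < j \<and> j \<le> CARD('n)}"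
      using ij by (intro span_base) auto
    moreover have "i \<in> {1..CARD('n) - 1}" using False ij by auto
    ultimately have "orthogonal (w j - w i) (w i)"
      using w unfolding orthoscheme_vertices_def Let_def by blast
    then have "w j \<bullet> w i = w i \<bullet> w i" by (simp add: orthogonal_def inner_diff_left)
    then show ?thesis using nrm by (simp add: inner_commute)
  qed (use nrm in simp)
qed

lemma positive_measure_simplex:
  fixes S :: "(real^'n) set"
  assumes "int CARD('n) simplex S"
  shows "0 < measure lebesgue S"
proof -
  have S: "convex S" "compact S" using assms by (auto intro: convex_simplex compact_simplex)
  have "aff_dim S = int DIM(real^'n)" using aff_dim_simplex[OF assms] by simp
  then have "affine hull S = UNIV" unfolding aff_dim_eq_full .
  then have "rel_interior S = interior S" by (rule rel_interior_interior)
  moreover have "S \<noteq> {}" using \<open>affine hull S = UNIV\<close> by auto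
  ultimately have "interior S \<noteq> {}" using rel_interior_eq_empty[OF S(1)] by simp
  then have "\<not> negligible S" using negligible_convex_interior[OF S(1)] by simp
  then show ?thesis
    using negligible_iff_measure0[OF lmeasurable_compact[OF S(2)]] by (simp add: less_le)
qed

text \<open>The plane of the corner triangle gets its origin at \<open>w (d - 2)\<close> and its real axis in the direction of
\<open>w (d - 1)\<close>. The legs of the triangle have lengths \<open>A\<close> and \<open>B\<close>, its hypotenuse has length \<open>r\<close>, and \<open>\<phi>\<close> is its
angle at \<open>w (d - 2)\<close>.\<close>

locale rogers_configuration =
  fixes w :: "nat \<Rightarrow> real^'n" and d :: nat
  assumes d: "d = CARD('n)" and d3: "d \<ge> 4"
    and ortho: "orthoscheme_vertices w"
    and arc: "arc_endpoint w"
begin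

definition "A = sqrt (2 / ((real d - 1) * real d))"
definition "B = sqrt (2 / (real d * (real d + 1)))"
definition "r = sqrt (A\<^sup>2 + B\<^sup>2)"
definition "\<phi> = arccos (A / r)"
definition "base = convex hull (insert 0 (w ` {1..d - 3}))"
definition "u = (1 / A) *\<^sub>R (w (d - 1) - w (d - 2))"
definition "v = (1 / B) *\<^sub>R (w d - w (d - 1))"

lemma A2: "A\<^sup>2 = 2 / ((real d - 1) * real d)" and B2: "B\<^sup>2 = 2 / (real d * (real d + 1))"
  using d3 by (simp_all add: A_def B_def)

lemma AB: "0 < B" "B < A" "0 < A"
proof -
  show "0 < B" using d3 by (simp add: B_def)
  have "0 < (real d - 1) * real d" "(real d - 1) * real d < real d * (real d + 1)"
    using d3 by (auto simp: algebra_simps intro!: mult_pos_pos)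
  then show "B < A" unfolding A_def B_def
    by (intro real_sqrt_less_mono divide_strict_left_mono) auto
  with \<open>0 < B\<close> show "0 < A" by simp
qed

lemma r: "0 < r" "r\<^sup>2 = A\<^sup>2 + B\<^sup>2"
  using AB by (auto simp: r_def intro!: add_pos_pos)

lemma phi: "cos \<phi> = A / r" "sin \<phi> = B / r" "0 < \<phi>" "\<phi> < pi / 4"
proof -
  have "A\<^sup>2 < r\<^sup>2" using r AB by simp
  then have "A < r" using r(1) by (intro power2_less_imp_less[of A r]) auto
  then have Ar: "0 < A / r" "A / r < 1" using AB r by auto
  then show cos: "cos \<phi> = A / r" by (simp add: \<phi>_def)
  have lu: "0 < \<phi>" "\<phi> \<le> pi"
  proof -
    show "\<phi> \<le> pi" using Ar by (simp add: \<phi>_def arccos_ubound)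
    have "0 \<le> \<phi>" using Ar by (simp add: \<phi>_def arccos_lbound)
    moreover have "\<phi> \<noteq> 0" using cos Ar by auto
    ultimately show "0 < \<phi>" by simp
  qed
  then show "0 < \<phi>" by simp
  have "(sin \<phi>)\<^sup>2 = (B / r)\<^sup>2"
  proof -
    have "B\<^sup>2 = r\<^sup>2 - A\<^sup>2" "r\<^sup>2 \<noteq> 0" using r by auto
    then show ?thesis by (simp add: sin_squared_eq cos power_divide diff_divide_distrib)
  qed
  then show "sin \<phi> = B / r"
    using sin_ge_zero[of \<phi>] lu AB r by (simp add: power2_eq_iff_nonneg)
  have "B\<^sup>2 < A\<^sup>2" using AB by (intro power_strict_mono) auto
  then have "r\<^sup>2 < (sqrt 2 * A)\<^sup>2" using r by (simp add: power_mult_distrib)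
  then have "r < sqrt 2 * A" using AB by (intro power2_less_imp_less[of r]) auto
  then have "sqrt 2 * r < sqrt 2 * (sqrt 2 * A)" by simp
  then have "sqrt 2 * r < 2 * A" by (simp flip: mult.assoc)
  then have "cos (pi / 4) < cos \<phi>" using r by (simp add: cos cos_45 field_simps)
  then show "\<phi> < pi / 4" using cos_mono_less_eq[of "pi / 4" \<phi>] lu by simp
qed

lemma gram: "1 \<le> i \<Longrightarrow> i \<le> j \<Longrightarrow> j \<le> d \<Longrightarrow> w i \<bullet> w j = 2 * real i / (real i + 1)"
  using orthoscheme_gram[OF ortho] unfolding d .

lemma w_points:
  "w (d - 1) = w (d - 2) + A *\<^sub>R u" "w d = w (d - 2) + A *\<^sub>R u + B *\<^sub>R v"
  using AB by (simp_all add: u_def v_def)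

lemma w_orth: "1 \<le> i \<Longrightarrow> i \<le> d - 2 \<Longrightarrow> w i \<bullet> u = 0" "1 \<le> i \<Longrightarrow> i \<le> d - 2 \<Longrightarrow> w i \<bullet> v = 0"
  using gram[of i "d - 2"] gram[of i "d - 1"] gram[of i d] d3
  by (simp_all add: u_def v_def inner_diff_right)

sublocale planar_join base "w (d - 2)" u v
proof
  show "convex base" "bounded base" "0 \<in> base"
    by (auto simp: base_def bounded_convex_hull finite_imp_bounded intro: hull_inc)
  show "h \<bullet> u = 0" "h \<bullet> v = 0" if "h \<in> base" for h
  proof -
    have "base \<subseteq> {x. x \<bullet> u = 0} \<inter> {x. x \<bullet> v = 0}"
      unfolding base_def
    proof (rule hull_minimal)
      show "convex ({x. x \<bullet> u = 0} \<inter> {x. x \<bullet> v = 0})"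
        unfolding inner_commute[of _ u] inner_commute[of _ v] by (intro convex_Int convex_hyperplane)
      show "insert 0 (w ` {1..d - 3}) \<subseteq> {x. x \<bullet> u = 0} \<inter> {x. x \<bullet> v = 0}"
        using w_orth d3 by auto
    qed
    then show "h \<bullet> u = 0" "h \<bullet> v = 0" using that by auto
  qed
  show "w (d - 2) \<bullet> u = 0" "w (d - 2) \<bullet> v = 0" using w_orth d3 by auto
  define e where "e = real d"
  have e: "real (d - 1) = e - 1" "real (d - 2) = e - 2" "e \<ge> 4" using d3 by (auto simp: e_def of_nat_diff)
  have g: "w (d - 2) \<bullet> w (d - 2) = 2 * (e - 2) / (e - 1)" "w (d - 2) \<bullet> w (d - 1) = 2 * (e - 2) / (e - 1)"
    "w (d - 2) \<bullet> w d = 2 * (e - 2) / (e - 1)" "w (d - 1) \<bullet> w (d - 1) = 2 * (e - 1) / e"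
    "w (d - 1) \<bullet> w d = 2 * (e - 1) / e" "w d \<bullet> w d = 2 * e / (e + 1)"
    using gram[of "d - 2" "d - 2"] gram[of "d - 2" "d - 1"] gram[of "d - 2" d] gram[of "d - 1" "d - 1"]
      gram[of "d - 1" d] gram[of d d] d3 by (simp_all add: e(1,2)) (simp_all add: e_def)
  have "(w (d - 1) - w (d - 2)) \<bullet> (w (d - 1) - w (d - 2)) = 2 * (e - 1) / e - 2 * (e - 2) / (e - 1)"
    using g by (simp add: inner_diff inner_commute)
  also have "\<dots> = A\<^sup>2" unfolding A2 e_def[symmetric] using e by (simp add: field_simps)
  finally show "u \<bullet> u = 1" using AB by (simp add: u_def power2_eq_square)
  have "(w d - w (d - 1)) \<bullet> (w d - w (d - 1)) = 2 * e / (e + 1) - 2 * (e - 1) / e"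
    using g by (simp add: inner_diff inner_commute)
  also have "\<dots> = B\<^sup>2" unfolding B2 e_def[symmetric] using e by (simp add: field_simps)
  finally show "v \<bullet> v = 1" using AB by (simp add: v_def power2_eq_square)
  show "u \<bullet> v = 0" using g by (simp add: u_def v_def inner_diff inner_commute)
qed

abbreviation place :: "complex \<Rightarrow> real^'n" where
  "place z \<equiv> w (d - 2) + pt z"

lemma place_w: "w (d - 1) = place (complex_of_real A)" "w d = place (r *\<^sub>R cis \<phi>)"
  unfolding w_points pt_def using r by (simp_all add: phi add.assoc)

lemma norm_pt: "norm (pt z) = norm z"
  by (subst norm_eq_sqrt_inner) (simp add: pt_def inner_add uv vu cmod_def power2_eq_square)

lemma inner_pt: "pt z \<bullet> pt z' = Re (z * cnj z')"
  by (simp add: pt_def inner_add uv vu)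

lemma corner_triangle_eq: "corner_triangle w = place ` truncated_cone 0 \<phi> A"
proof -
  have tri: "corner_triangle w =
      {w (d - 2) + s *\<^sub>R (A *\<^sub>R u) + t *\<^sub>R (A *\<^sub>R u + B *\<^sub>R v) | s t. 0 \<le> s \<and> 0 \<le> t \<and> s + t \<le> 1}"
    unfolding corner_triangle_def Let_def d[symmetric] convex_hull_3_alt w_points by (simp add: add.assoc)
  have "w (d - 2) + s *\<^sub>R (A *\<^sub>R u) + t *\<^sub>R (A *\<^sub>R u + B *\<^sub>R v)
      = place ((s + t) *\<^sub>R complex_of_real A + t *\<^sub>R Complex 0 B)" for s t
    by (simp add: pt_def algebra_simps)
  then show ?thesis
    unfolding truncated_cone_eq_triangle[OF AB(3,1) r(1) phi(1,2)] image_Collect2[of place, symmetric] tri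
    by (simp only:)
qed

lemma angle_corner: "angle_at (w (d - 2)) (w (d - 1)) (w d) = \<phi>"
proof -
  have "(A * (r * cos \<phi>)) / (A * r) = A / r" using AB r phi by simp
  then show ?thesis
    unfolding angle_at_def place_w \<phi>_def using AB r
    by (simp add: norm_pt inner_pt norm_mult)
qed

text \<open>The norm and the angle leave two positions for \<open>w (d + 1)\<close>, mirror images in the line through \<open>w (d - 2)\<close>
and \<open>w d\<close>. The separating line excludes the one on the side of the triangle.\<close>

lemma arc_endpoint_eq: "w (d + 1) = place (r *\<^sub>R cis (pi / 4))"
proof -
  define \<delta> where "\<delta> = pi / 4 - \<phi>"
  have \<delta>: "0 < \<delta>" "\<delta> < pi" using phi by (auto simp: \<delta>_def)
  let ?P = "affine hull {w (d - 2), w (d - 1), w d}"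
  have inP: "w (d + 1) \<in> ?P" and nrm: "norm (w (d + 1) - w (d - 2)) = norm (w d - w (d - 2))"
    and ang: "angle_at (w (d - 2)) (w d) (w (d + 1)) = \<delta>"
    using arc angle_corner unfolding arc_endpoint_def Let_def d[symmetric] \<delta>_def by auto
  obtain n b where nb: "?P \<inter> {x. n \<bullet> x = b} = affine hull {w (d - 2), w d}"
      "\<And>x. x \<in> corner_triangle w \<Longrightarrow> n \<bullet> x \<le> b" "\<And>x. x \<in> corner_sector w \<Longrightarrow> b \<le> n \<bullet> x"
    using arc unfolding arc_endpoint_def Let_def d[symmetric] by blast
  obtain \<zeta> where \<zeta>: "w (d + 1) = place \<zeta>"
  proof -
    obtain l m k where lm: "w (d + 1) = l *\<^sub>R w (d - 2) + m *\<^sub>R w (d - 1) + k *\<^sub>R w d" "l + m + k = 1"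
      using inP unfolding affine_hull_3 by auto
    have "w (d + 1) = (l + m + k) *\<^sub>R w (d - 2) + (m *\<^sub>R pt (complex_of_real A) + k *\<^sub>R pt (r *\<^sub>R cis \<phi>))"
      unfolding lm(1) place_w by (simp add: algebra_simps)
    also have "\<dots> = place (m *\<^sub>R complex_of_real A + k *\<^sub>R (r *\<^sub>R cis \<phi>))"
      unfolding lm(2) linear_add[OF linear_pt] linear_scale[OF linear_pt] by simp
    finally show ?thesis using that by blast
  qed
  have nz: "norm \<zeta> = r" using nrm r unfolding \<zeta> place_w by (simp add: norm_pt)
  \<comment> \<open>\<open>\<eta>\<close> is \<open>\<zeta>\<close> in the coordinates whose real axis points to \<open>w d\<close>; its two possible values are
    complex conjugates.\<close>
  define \<eta> where "\<eta> = \<zeta> * cis (- \<phi>)"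
  have n\<eta>: "norm \<eta> = r" using nz by (simp add: \<eta>_def norm_mult)
  have "Re \<eta> = r * cos \<delta>"
  proof -
    have re: "pt (r *\<^sub>R cis \<phi>) \<bullet> pt \<zeta> = r * Re \<eta>"
      unfolding inner_pt \<eta>_def by (simp add: algebra_simps)
    have "angle_at (w (d - 2)) (w d) (w (d + 1)) = arccos (r * Re \<eta> / (r * r))"
      unfolding angle_at_def \<zeta> place_w using r nz by (simp add: norm_pt re)
    also have "r * Re \<eta> / (r * r) = Re \<eta> / r" using r by simp
    finally have "arccos (Re \<eta> / r) = \<delta>" using ang by simp
    moreover have "\<bar>Re \<eta> / r\<bar> \<le> 1" using abs_Re_le_cmod[of \<eta>] n\<eta> r by simp
    ultimately have "Re \<eta> / r = cos \<delta>" using cos_arccos_abs by metis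
    then show ?thesis using r by (simp add: field_simps)
  qed
  moreover have "Im \<eta> = r * sin \<delta>"
  proof -
    have "(Re \<eta>)\<^sup>2 + (Im \<eta>)\<^sup>2 = r\<^sup>2" using n\<eta> by (metis cmod_power2)
    then have "(Im \<eta>)\<^sup>2 = (r * sin \<delta>)\<^sup>2"
      unfolding \<open>Re \<eta> = r * cos \<delta>\<close> by (simp add: power_mult_distrib sin_squared_eq algebra_simps)
    moreover have "0 \<le> r * sin \<delta>" using r \<delta> by (simp add: sin_ge_zero)
    moreover have "0 \<le> Im \<eta>"
    proof -
      have line: "w (d - 2) \<in> affine hull {w (d - 2), w d}" "w d \<in> affine hull {w (d - 2), w d}"
        by (simp_all add: hull_inc)
      then have b: "n \<bullet> w (d - 2) = b" "n \<bullet> w d = b" using nb(1) by blast+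
      have L: "n \<bullet> place z = b + Re z * (n \<bullet> u) + Im z * (n \<bullet> v)" for z
        by (simp add: pt_def inner_add_right b)
      have q: "A * (n \<bullet> u) + B * (n \<bullet> v) = 0"
        using b(2) L[of "r *\<^sub>R cis \<phi>"] r by (simp add: place_w(2)[symmetric] phi)
      have "w (d - 1) \<in> corner_triangle w"
        unfolding corner_triangle_def Let_def d[symmetric] by (intro hull_inc) simp
      then have "n \<bullet> w (d - 1) \<le> b" by (rule nb(2))
      then have "A * (n \<bullet> u) \<le> 0" using L[of A] unfolding place_w(1) by simp
      moreover have "n \<bullet> u \<noteq> 0"
      proof
        assume 0: "n \<bullet> u = 0"
        then have "n \<bullet> w (d - 1) = b" using L[of A] by (simp add: place_w(1)[symmetric])
        then have "w (d - 1) \<in> affine hull {w (d - 2), w d}"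
          unfolding nb(1)[symmetric] by (simp add: hull_inc)
        then obtain l m where lm: "w (d - 1) = l *\<^sub>R w (d - 2) + m *\<^sub>R w d" "l + m = 1"
          unfolding affine_hull_2 by auto
        have "place (complex_of_real A) = (l + m) *\<^sub>R w (d - 2) + m *\<^sub>R pt (r *\<^sub>R cis \<phi>)"
          using lm(1) unfolding place_w by (simp only: scaleR_add_left scaleR_add_right add.assoc)
        then have "pt (complex_of_real A) = pt (m *\<^sub>R r *\<^sub>R cis \<phi>)"
          by (simp add: lm(2) linear_scale[OF linear_pt])
        then have "complex_of_real A = m *\<^sub>R r *\<^sub>R cis \<phi>" by (metis proj_pt)
        then have "A = m * A" "0 = m * B" using r by (auto simp: complex_eq_iff phi)
        then show False using AB by auto
      qed
      ultimately have nu: "n \<bullet> u < 0" using AB by (simp add: mult_le_0_iff)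
      have "w (d + 1) \<in> corner_sector w"
      proof -
        have "w (d + 1) \<in> cball (w (d - 2)) (dist (w (d - 2)) (w d))"
          using nrm by (simp add: dist_norm norm_minus_commute)
        moreover have "w (d + 1) = w (d - 2) + 0 *\<^sub>R (w d - w (d - 2)) + 1 *\<^sub>R (w (d + 1) - w (d - 2))" by simp
        then have "w (d + 1) \<in> {w (d - 2) + s *\<^sub>R (w d - w (d - 2)) + t *\<^sub>R (w (d + 1) - w (d - 2)) | s t. 0 \<le> s \<and> 0 \<le> t}"
          by (intro CollectI exI[of _ 0] exI[of _ 1] conjI) auto
        ultimately show ?thesis
          unfolding corner_sector_def circular_sector_def Let_def d[symmetric] by (rule IntI)
      qed
      then have "0 \<le> Re \<zeta> * (n \<bullet> u) + Im \<zeta> * (n \<bullet> v)" using nb(3) L[of \<zeta>] unfolding \<zeta> by fastforce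
      then have "0 \<le> B * (Re \<zeta> * (n \<bullet> u) + Im \<zeta> * (n \<bullet> v))" using AB by simp
      also have "\<dots> = (n \<bullet> u) * (B * Re \<zeta> - A * Im \<zeta>)"
      proof -
        have "B * (n \<bullet> v) = - (A * (n \<bullet> u))" using q by simp
        then have "Im \<zeta> * (B * (n \<bullet> v)) = Im \<zeta> * - (A * (n \<bullet> u))" by simp
        then show ?thesis by (simp add: algebra_simps)
      qed
      finally have "B * Re \<zeta> \<le> A * Im \<zeta>" using nu by (simp add: zero_le_mult_iff)
      moreover have "Im \<eta> = (A * Im \<zeta> - B * Re \<zeta>) / r"
        by (simp add: \<eta>_def phi diff_divide_distrib mult.commute)
      ultimately show ?thesis using r by simp
    qed
    ultimately show ?thesis by (simp add: power2_eq_iff_nonneg)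
  qed
  ultimately have "\<eta> = r *\<^sub>R cis \<delta>" by (simp add: complex_eq_iff)
  then have "\<zeta> = r *\<^sub>R cis \<delta> * cis \<phi>"
    by (metis \<eta>_def cis_mult cis_zero add.left_inverse mult.assoc mult_1_right)
  also have "\<dots> = r *\<^sub>R cis (pi / 4)" by (simp add: cis_mult \<delta>_def)
  finally show ?thesis using \<zeta> by simp
qed

lemma corner_sector_eq: "corner_sector w = place ` sector \<phi> (pi / 4) r"
proof -
  have r: "0 < r" using r by simp
  have diff: "w d - w (d - 2) = pt (r *\<^sub>R cis \<phi>)" "w (d + 1) - w (d - 2) = pt (r *\<^sub>R cis (pi / 4))"
    unfolding arc_endpoint_eq place_w by simp_all
  have dist: "dist (w (d - 2)) (w d) = r" using r by (simp add: place_w dist_norm norm_pt)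
  have comb: "w (d - 2) + s *\<^sub>R pt (r *\<^sub>R cis \<phi>) + t *\<^sub>R pt (r *\<^sub>R cis (pi / 4)) =
      place (s *\<^sub>R (r *\<^sub>R cis \<phi>) + t *\<^sub>R (r *\<^sub>R cis (pi / 4)))" for s t
    by (simp only: linear_add[OF linear_pt] linear_scale[OF linear_pt] add.assoc)
  have cone: "angular_cone \<phi> (pi / 4) = {s *\<^sub>R (r *\<^sub>R cis \<phi>) + t *\<^sub>R (r *\<^sub>R cis (pi / 4)) | s t. 0 \<le> s \<and> 0 \<le> t}"
    using phi r by (intro angular_cone_eq_span) auto
  have "corner_sector w = cball (w (d - 2)) r \<inter> {place (s *\<^sub>R (r *\<^sub>R cis \<phi>) + t *\<^sub>R (r *\<^sub>R cis (pi / 4))) | s t. 0 \<le> s \<and> 0 \<le> t}"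
    by (simp only: corner_sector_def circular_sector_def Let_def d[symmetric] diff dist comb)
  then have "corner_sector w = cball (w (d - 2)) r \<inter> place ` angular_cone \<phi> (pi / 4)"
    unfolding cone image_Collect2[of place] .
  also have "\<dots> = place ` (angular_cone \<phi> (pi / 4) \<inter> cball 0 r)"
  proof -
    have "S \<inter> h ` K = h ` (K \<inter> S')" if "\<And>z. h z \<in> S \<longleftrightarrow> z \<in> S'"
      for h :: "complex \<Rightarrow> real^'n" and S S' K using that by auto
    moreover have "place z \<in> cball (w (d - 2)) r \<longleftrightarrow> z \<in> cball 0 r" for z
      by (simp add: dist_norm norm_pt)
    ultimately show ?thesis .
  qed
  finally show ?thesis unfolding sector_def .
qed

text \<open>The hypotenuse has the length of the radius of the sector, so the circle contains the triangle and
the line through \<open>w (d - 1)\<close> and \<open>w d\<close> bounds the sector. The union is then what the circle and this line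
cut out of a single cone.\<close>

lemma convex_corner: "convex (truncated_cone 0 \<phi> A \<union> sector \<phi> (pi / 4) r)"
proof -
  have rA: "A / cos \<phi> = r" using phi AB r by simp
  have "truncated_cone 0 \<phi> A \<subseteq> cball 0 r"
    using truncated_cone_subset_sector[of 0 \<phi> A] phi unfolding rA by (auto simp: sector_def)
  moreover have "sector \<phi> (pi / 4) r \<subseteq> {z. Re z \<le> A}"
    using sector_subset_truncated_cone[of \<phi> "pi / 4" A] phi unfolding rA by (auto simp: truncated_cone_def)
  ultimately have "truncated_cone 0 \<phi> A \<union> sector \<phi> (pi / 4) r
      = (angular_cone 0 \<phi> \<union> angular_cone \<phi> (pi / 4)) \<inter> (cball 0 r \<inter> {z. Re z \<le> A})"
    unfolding truncated_cone_def sector_def by blast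
  also have "angular_cone 0 \<phi> \<union> angular_cone \<phi> (pi / 4) = angular_cone 0 (pi / 4)"
    using angular_cone_split[of 0 \<phi> "pi / 4"] phi by simp
  finally show ?thesis
    by (simp add: convex_Int convex_angular_cone convex_halfspace_Re_le)
qed

lemma truncated_cone_nonempty: "truncated_cone 0 \<phi> A \<noteq> {}"
  using AB(3) unfolding truncated_cone_def by (metis (mono_tags) zero_in_angular_cone Int_iff empty_iff mem_Collect_eq zero_complex.sel(1) less_imp_le)

lemma convex_body_eq: "convex_body_W w = join (truncated_cone 0 \<phi> A \<union> sector \<phi> (pi / 4) r)"
proof -
  have "convex_body_W w = convex hull (insert 0 (w ` {1..d - 3}) \<union> place ` (truncated_cone 0 \<phi> A \<union> sector \<phi> (pi / 4) r))"
    unfolding convex_body_W_def corner_triangle_eq corner_sector_eq image_Un d ..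
  also have "\<dots> = convex hull (base \<union> place ` (truncated_cone 0 \<phi> A \<union> sector \<phi> (pi / 4) r))"
    unfolding base_def by (rule hull_Un_left)
  also have "\<dots> = join (truncated_cone 0 \<phi> A \<union> sector \<phi> (pi / 4) r)"
    using convex_corner truncated_cone_nonempty by (intro join_eq_convex_hull[symmetric]) auto
  finally show ?thesis .
qed

lemma orthoscheme_eq: "convex hull (insert 0 (w ` {1..d})) = join (truncated_cone 0 \<phi> A)"
proof -
  have "{1..d} = {1..d - 3} \<union> {d - 2, d - 1, d}" using d3 by auto
  then have "insert 0 (w ` {1..d}) = insert 0 (w ` {1..d - 3}) \<union> {w (d - 2), w (d - 1), w d}"
    by (simp add: image_Un insert_commute)
  then have "convex hull (insert 0 (w ` {1..d})) = convex hull (base \<union> corner_triangle w)"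
    unfolding base_def corner_triangle_def Let_def d[symmetric]
    using hull_Un_left hull_Un_right by metis
  also have "\<dots> = join (truncated_cone 0 \<phi> A)"
    unfolding corner_triangle_eq
    using convex_truncated_cone truncated_cone_nonempty by (intro join_eq_convex_hull[symmetric]) auto
  finally show ?thesis .
qed

lemma density_less:
  "rogers_sigma_hat w < measure lebesgue (convex hull (insert 0 (w ` {1..d})) \<inter> cball 0 1) /
     measure lebesgue (convex hull (insert 0 (w ` {1..d})))"
proof -
  have "1 \<le> norm (w (d - 2))"
  proof -
    have "norm (w (d - 2)) = sqrt (2 * real (d - 2) / (real (d - 2) + 1))"
      using gram[of "d - 2" "d - 2"] d3 by (simp add: norm_eq_sqrt_inner)
    also have "1 \<le> \<dots>" using d3 by simp
    finally show ?thesis .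
  qed
  moreover have "0 < vol (truncated_cone 0 \<phi> A)"
    unfolding vol_def orthoscheme_eq[symmetric]
    using ortho by (intro positive_measure_simplex) (simp add: orthoscheme_vertices_def Let_def d)
  moreover have "A / cos \<phi> = r" using phi AB r by simp
  ultimately show ?thesis
    unfolding rogers_sigma_hat_def convex_body_eq orthoscheme_eq
    using sector_lowers_density[of A \<phi> "pi / 4"] AB phi by (simp add: vol_def ball_vol_def)
qed

end

theorem mainTheorem3:
  fixes V :: "(real^'n) set" and w :: "nat \<Rightarrow> real^'n"
  assumes "CARD('n) \<ge> 8"
    and "regular_simplex_vertices 2 V"
    and "orthoscheme_vertices w" and "arc_endpoint w"
  shows "rogers_sigma_hat w < rogers_sigma V"
proof -
  \<comment> \<open>The value \<open>w 0\<close> is unspecified; the orthoscheme has the vertex \<open>0\<close> in its place.\<close>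
  let ?w = "w(0 := 0)"
  interpret rogers_configuration w "CARD('n)"
    using assms by unfold_locales auto
  interpret orthoscheme ?w
  proof
    show "?w i \<bullet> ?w j = 2 * real i / (real i + 1)" if "i \<le> j" "j \<le> CARD('n)" for i j
      using that orthoscheme_gram[OF assms(3), of i j] by (cases "i = 0") auto
  qed simp
  have "{..CARD('n)} = insert 0 {1..CARD('n)}" by auto
  then have "?w ` {..CARD('n)} = insert 0 (w ` {1..CARD('n)})" by auto
  then show ?thesis
    using density_less rogers_sigma_eq_orthoscheme[OF assms(2)] by simp
qed

end
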